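(* There exists $\ell = \Omega(1)$ such that the following holds. Let $A^\ast \in \mathbb{R}^{W\times D}$ and let the data be generated i.i.d. as $y = A^\ast x$, where $x \in \{0,1\}^D$ is a random vector satisfying the $(r,k,m,\lambda)$-general correlation conditions with $\lambda>0$. Then for every $\epsilon > 0$, Algorithm AND, run with $T = \mathrm{poly}(D, \frac1\epsilon)$, $\eta = \frac{1}{\mathrm{poly}(D,\frac1\epsilon)}$, thresholds $\alpha_i = \frac14$ for $i=1,\dots,s$ with $s = \mathrm{polylog}(D,\frac1\epsilon)$, and an $\ell$-initialization matrix $A_0$, outputs a matrix $A$ for which there exists a diagonal matrix $\Sigma \succeq \frac12 I$ with $\|A - A^\ast \Sigma\|_2 \le \epsilon$, using $\mathrm{poly}(D,\frac1\epsilon)$ samples and iterations, as long as $$m = O\left(\frac{k D \lambda^4}{r^5}\right).$$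
   Context: $O(\cdot)$ and $\Omega(\cdot)$ hide absolute constants; $m=O(Q)$ as a hypothesis means $m\le cQ$ for a sufficiently small absolute constant $c>0$. $\|\cdot\|_2$ of a matrix is the spectral norm. "Off-diagonal matrix" means a matrix with zero diagonal. $[D]=\{1,\dots,D\}$. General correlation conditions (GCC). A non-negative random vector $x\in\mathbb{R}^D$ (distribution $\mu$) satisfies $(r,k,m,\lambda)$-GCC if, with $\Delta := \mathbb{E}[xx^\top]$: (1) $\|x\|_1\le r$ and $x_i\in[0,1]$ for all $i\in[D]$; (2) $\Delta_{i,i}\le \frac{2k}{D}$ for all $i\in[D]$; (3) $\Delta_{i,j}\le \frac{m}{D^2}$ for all $i\ne j\in[D]$; (4) $\Delta \succeq \frac{k}{D}\lambda I$. $\ell$-initialization. For $\ell\in[0,1)$, a matrix $A_0$ is an $\ell$-initialization if $A_0 = A^\ast(\Sigma_{\mathrm{in}}+E_{\mathrm{in}})$ for some diagonal $\Sigma_{\mathrm{in}}$ and off-diagonal $E_{\mathrm{in}}$ with $\|E_{\mathrm{in}}\|_2\le \ell$ and $\|\Sigma_{\mathrm{in}}-I\|_2\le\frac14$. Thresholding. $\phi_\alpha(v)=v$ if $v\ge\alpha$ and $\phi_\alpha(v)=0$ otherwise, applied coordinatewise to vectors. Algorithm AND. Input: thresholds (one per stage), $T$, step size $\eta$, $A_0$. Set $A^{(0)}\leftarrow A_0$. For each stage $j$ (with threshold $\alpha_j$): for $t=0,1,\dots,T$, draw a fresh sample $y^{(t)}$, set $z^{(t)} \leftarrow \phi_{\alpha_j}\big((A^{(0)})^\dagger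 y^{(t)}\big)$ and $A^{(t+1)}\leftarrow A^{(t)}+\eta\,(y^{(t)}-A^{(t)}z^{(t)})(z^{(t)})^\top$; at the end of the stage set $A^{(0)}\leftarrow A^{(T+1)}$. Output the last $A^{(T+1)}$. Here $\dagger$ is the Moore–Penrose pseudo-inverse; within a stage $A^{(0)}$ is fixed in the decoding step.
   Formalization: Formal version assumes A* has full column rank and k>0; the poly bounds may also depend on 1/k, 1/λ and a bound on ‖A*‖₂ (polylog s on the latter only), since the literal claim fails otherwise; the output guarantee holds with probability at least 1 − 1/X^q for any fixed q. *)

theory Defs
  imports
    "HOL-Probability.Probability_Mass_Function"
    "HOL-Library.Monad_Syntax"
    "Jordan_Normal_Form.DL_Rank"
begin

unbundle no vec_syntax
unbundle no inner_syntax

(* Matrices and vectors carry their dimensions as natural numbers, because the absolute constants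
   of the theorem must not depend on the dimensions; indices run from 0. *)

text \<open>Spectral norm: the operator norm induced by the Euclidean norm.\<close>

definition spec_norm :: "real mat \<Rightarrow> real" where
  "spec_norm A =
     (SUP v \<in> {v \<in> carrier_vec (dim_col A). v \<bullet> v \<le> 1}. sqrt ((A *\<^sub>v v) \<bullet> (A *\<^sub>v v)))"

definition psd :: "real mat \<Rightarrow> bool" where
  "psd P \<longleftrightarrow> square_mat P \<and> transpose_mat P = P \<and>
     (\<forall>v \<in> carrier_vec (dim_row P). 0 \<le> v \<bullet> (P *\<^sub>v v))"

definition loewner_ge :: "real mat \<Rightarrow> real mat \<Rightarrow> bool" where
  "loewner_ge P Q \<longleftrightarrow> psd (P - Q)"

definition off_diagonal_mat :: "real mat \<Rightarrow> bool" where
  "off_diagonal_mat E \<longleftrightarrow> (\<forall>i < dim_row E. i < dim_col E \<longrightarrow> E $$ (i, i) = 0)"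

text \<open>The Moore--Penrose pseudo-inverse, as the unique solution of the four Penrose equations.\<close>

definition is_pinv :: "real mat \<Rightarrow> real mat \<Rightarrow> bool" where
  "is_pinv A B \<longleftrightarrow> B \<in> carrier_mat (dim_col A) (dim_row A) \<and>
     A * B * A = A \<and> B * A * B = B \<and>
     transpose_mat (A * B) = A * B \<and> transpose_mat (B * A) = B * A"

definition pinv :: "real mat \<Rightarrow> real mat" where
  "pinv A = (THE B. is_pinv A B)"

definition outer :: "real vec \<Rightarrow> real vec \<Rightarrow> real mat" where
  "outer u v = mat (dim_vec u) (dim_vec v) (\<lambda>(i, j). u $ i * v $ j)"

text \<open>The matrix of second moments of a random vector.\<close>

definition second_moment :: "nat \<Rightarrow> real vec pmf \<Rightarrow> real mat" where
  "second_moment D \<mu> = mat D D (\<lambda>(i, j). measure_pmf.expectation \<mu> (\<lambda>x. x $ i * x $ j))"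

(* A discrete law is enough here: the random vectors of interest take values in {0,1}^D. *)
definition gcc :: "nat \<Rightarrow> real \<Rightarrow> real \<Rightarrow> real \<Rightarrow> real \<Rightarrow> real vec pmf \<Rightarrow> bool" where
  "gcc D r k m lam \<mu> \<longleftrightarrow>
     (\<forall>x \<in> set_pmf \<mu>. x \<in> carrier_vec D \<and> (\<Sum>i<D. \<bar>x $ i\<bar>) \<le> r \<and> (\<forall>i<D. x $ i \<in> {0..1})) \<and>
     (\<forall>i<D. second_moment D \<mu> $$ (i, i) \<le> 2 * k / real D) \<and>
     (\<forall>i<D. \<forall>j<D. i \<noteq> j \<longrightarrow> second_moment D \<mu> $$ (i, j) \<le> m / (real D)\<^sup>2) \<and>
     loewner_ge (second_moment D \<mu>) ((k / real D * lam) \<cdot>\<^sub>m 1\<^sub>m D)"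

definition initialization :: "nat \<Rightarrow> real \<Rightarrow> real mat \<Rightarrow> real mat \<Rightarrow> bool" where
  "initialization D l Astar A0 \<longleftrightarrow>
     (\<exists>S \<in> carrier_mat D D. \<exists>E \<in> carrier_mat D D.
        diagonal_mat S \<and> off_diagonal_mat E \<and> A0 = Astar * (S + E) \<and>
        spec_norm E \<le> l \<and> spec_norm (S - 1\<^sub>m D) \<le> 1 / 4)"

definition thresh :: "real \<Rightarrow> real vec \<Rightarrow> real vec" where
  "thresh \<alpha> v = map_vec (\<lambda>a. if a \<ge> \<alpha> then a else 0) v"

text \<open>The law of the iterate \<open>A\<^sup>(\<^sup>t\<^sup>)\<close> within one stage, for observations drawn independently
  from \<open>Y\<close>; decoding always uses the matrix \<open>A0\<close> with which the stage starts.\<close>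

primrec and_iterate ::
  "real vec pmf \<Rightarrow> real \<Rightarrow> real \<Rightarrow> real mat \<Rightarrow> nat \<Rightarrow> real mat pmf" where
  "and_iterate Y \<alpha> \<eta> A0 0 = return_pmf A0"
| "and_iterate Y \<alpha> \<eta> A0 (Suc t) = do {
     A \<leftarrow> and_iterate Y \<alpha> \<eta> A0 t;
     y \<leftarrow> Y;
     let z = thresh \<alpha> (pinv A0 *\<^sub>v y);
     return_pmf (A + \<eta> \<cdot>\<^sub>m outer (y - A *\<^sub>v z) z)
   }"

text \<open>The law of the output, for a list of thresholds with one entry per stage. A stage performs the
  updates \<open>t = 0, \<dots>, T\<close>, hence consumes \<open>T + 1\<close> samples.\<close>

primrec AND ::
  "real vec pmf \<Rightarrow> nat \<Rightarrow> real \<Rightarrow> real list \<Rightarrow> real mat \<Rightarrow> real mat pmf" where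
  "AND Y T \<eta> [] A0 = return_pmf A0"
| "AND Y T \<eta> (\<alpha> # \<alpha>s) A0 = do {
     A \<leftarrow> and_iterate Y \<alpha> \<eta> A0 (Suc T);
     AND Y T \<eta> \<alpha>s A
   }"

end

theory Submission
  imports Defs
begin

text \<open>
  All iterates have the form \<open>Astar * M\<close>, so only the \<open>D\<close>-by-\<open>D\<close> factor \<open>M\<close> matters. Within a stage that
  starts at \<open>M = S + F\<close> (diagonal plus off-diagonal), put \<open>G = M\<^sup>-\<^sup>1\<close>; the code is \<open>z = thresh (1/4) (G x)\<close>
  and the stage is stochastic gradient descent for the linear regression of \<open>x\<close> on \<open>z\<close>, whose
  minimiser is \<open>E[x z\<^sup>T] E[z z\<^sup>T]\<^sup>-\<^sup>1\<close>. Write \<open>z = diag(G) x + b\<close>. By a Schur test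
  \<open>E \<langle>v, b\<rangle>\<^sup>2 \<le> (max |b|\<^sub>1) (max E |b\<^sub>i|) |v|\<^sup>2\<close>. The first factor is \<open>O(r |F|)\<close>. The second is small because
  an error at coordinate \<open>i\<close> requires two coordinates of \<open>x\<close> to be active simultaneously: either
  \<open>x\<^sub>i = 1\<close> and another one, or, owing to the threshold, at least two coordinates with
  \<open>|G\<^sub>i\<^sub>l| \<ge> 1/(8r)\<close>. Hence the minimiser is within \<open>|F|/100\<close> of a diagonal matrix, the off-diagonal
  part halves in each stage, and the diagonal drifts by a geometric series. The sampling error is
  controlled by the expected squared Frobenius distance to the minimiser and Markov's inequality.
\<close>

section \<open>Euclidean norm, spectral norm and pseudo-inverse\<close>

text \<open>The off-diagonal part can keep halving down to any accuracy only if every error term is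
  proportional to its current size \<open>e\<close>; a fixed additive error would stall it. This is
  why the code is compared with \<open>diag(G) x\<close> and not with \<open>x\<close>: a diagonal
  rescaling is allowed in the output and is no error. The decoder is frozen during a stage, so
  \<open>z\<close> depends on \<open>x\<close> alone and the objective is a convex quadratic. Full
  column rank gives \<open>pinv (Astar * M) * Astar = M^-1\<close>, so the conditioning of
  \<open>Astar\<close> never enters, only its norm, when the accuracy of the factor is converted
  into that of the output. The size required of the decoding error comes from the eigenvalue bound
  \<open>k lam / D\<close> of the second moments: the Schur product must be a small multiple of
  \<open>e^2 k lam / D\<close>, and its sure factor is \<open>O(r e)\<close>, so
  \<open>E |b_i|\<close> must be a small multiple of \<open>e k lam / (r D)\<close>. The constant
  \<open>2 * 10^20\<close> makes the Cauchy-Schwarz square root equal to \<open>10^10\<close>. The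
  value \<open>l = 1/200\<close> ensures \<open>12 l \<le> 1/16\<close>, needed for decoding, and
  \<open>1/4 + 38 l \<le> 1/2\<close>, needed for the diagonal.\<close>

lemma le_of_mult_self_le: "a * a \<le> c * a \<Longrightarrow> 0 \<le> a \<Longrightarrow> 0 \<le> c \<Longrightarrow> a \<le> c" for a c :: real
  using mult_right_le_imp_le[of a a c] by (cases "a = 0") auto

text \<open>Encoded by \<open>L2_set\<close>, whose triangle and Cauchy-Schwarz inequalities carry
  over; \<open>vnorm_sqrt\<close> links it to the scalar product inside
  \<open>spec_norm\<close>.\<close>

definition vnorm :: "real vec \<Rightarrow> real" where
  "vnorm v = L2_set (\<lambda>i. v $ i) {..<dim_vec v}"

text \<open>A spectral norm bound freed of the supremum, so that bounds add and compose directly;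
  \<open>spec_norm_leI\<close> and \<open>spec_norm_leD\<close> translate.\<close>

definition op_le :: "real mat \<Rightarrow> real \<Rightarrow> bool" where
  "op_le A c \<longleftrightarrow> (\<forall>v \<in> carrier_vec (dim_col A). vnorm (A *\<^sub>v v) \<le> c * vnorm v)"

lemma scalar_prod_sum: "w \<in> carrier_vec n \<Longrightarrow> v \<bullet> w = (\<Sum>i<n. v $ i * w $ i)"
  for v w :: "real vec"
  by (auto simp: scalar_prod_def atLeast0LessThan)

lemma vnorm_sq: "v \<in> carrier_vec n \<Longrightarrow> (vnorm v)\<^sup>2 = (\<Sum>i<n. (v $ i)\<^sup>2)"
  by (auto simp: vnorm_def L2_set_def sum_nonneg)

lemma vnorm_nonneg [simp]: "0 \<le> vnorm v"
  by (simp add: vnorm_def)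

lemma vnorm_sq_scalar_prod: "(vnorm v)\<^sup>2 = v \<bullet> v"
  using vnorm_sq[of v "dim_vec v"] scalar_prod_sum[of v "dim_vec v" v]
  by (simp add: power2_eq_square)

lemma vnorm_sqrt: "vnorm v = sqrt (v \<bullet> v)"
  by (simp flip: vnorm_sq_scalar_prod)

lemma vnorm_zero [simp]: "vnorm (0\<^sub>v n) = 0"
  by (simp add: vnorm_def L2_set_def)

lemma vnorm_eq_0: "v \<in> carrier_vec n \<Longrightarrow> vnorm v = 0 \<longleftrightarrow> v = 0\<^sub>v n"
  by (auto simp: vnorm_def L2_set_def sum_nonneg_eq_0_iff intro!: eq_vecI)

lemma vnorm_add: "v \<in> carrier_vec n \<Longrightarrow> w \<in> carrier_vec n \<Longrightarrow> vnorm (v + w) \<le> vnorm v + vnorm w"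
  using L2_set_triangle_ineq[of "\<lambda>i. v $ i" "\<lambda>i. w $ i" "{..<n}"]
  by (auto simp: vnorm_def L2_set_def)

lemma vnorm_smult: "vnorm (c \<cdot>\<^sub>v v) = \<bar>c\<bar> * vnorm v"
  by (auto simp: vnorm_def L2_set_def power_mult_distrib real_sqrt_mult simp flip: sum_distrib_left)

lemma vnorm_uminus [simp]: "vnorm (- v) = vnorm v"
  by (simp add: vnorm_def L2_set_def)

lemma vnorm_diff: "v \<in> carrier_vec n \<Longrightarrow> w \<in> carrier_vec n \<Longrightarrow> vnorm (v - w) \<le> vnorm v + vnorm w"
  using vnorm_add[of v n "- w"] by (simp add: minus_add_uminus_vec)

lemma vnorm_cauchy:
  assumes "v \<in> carrier_vec n" "w \<in> carrier_vec n"
  shows "\<bar>v \<bullet> w\<bar> \<le> vnorm v * vnorm w"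
proof -
  have "\<bar>v \<bullet> w\<bar> \<le> (\<Sum>i<n. \<bar>v $ i\<bar> * \<bar>w $ i\<bar>)"
    using assms by (auto simp: scalar_prod_sum abs_mult intro: order_trans[OF sum_abs])
  also have "\<dots> \<le> vnorm v * vnorm w"
    using L2_set_mult_ineq[of "\<lambda>i. v $ i" "\<lambda>i. w $ i" "{..<n}"] assms by (auto simp: vnorm_def)
  finally show ?thesis .
qed

lemma op_leD: "op_le A c \<Longrightarrow> A \<in> carrier_mat m n \<Longrightarrow> v \<in> carrier_vec n \<Longrightarrow> vnorm (A *\<^sub>v v) \<le> c * vnorm v"
  by (auto simp: op_le_def)

lemma op_leI: "A \<in> carrier_mat m n \<Longrightarrow> (\<And>v. v \<in> carrier_vec n \<Longrightarrow> vnorm (A *\<^sub>v v) \<le> c * vnorm v) \<Longrightarrow> op_le A c"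
  by (auto simp: op_le_def)

lemma op_le_mono: "op_le A c \<Longrightarrow> c \<le> d \<Longrightarrow> op_le A d"
  unfolding op_le_def by (meson mult_right_mono order_trans vnorm_nonneg)

lemma op_le_add:
  assumes "op_le A c" "op_le B d" "A \<in> carrier_mat m n" "B \<in> carrier_mat m n"
  shows "op_le (A + B) (c + d)"
proof (rule op_leI)
  fix v :: "real vec" assume v: "v \<in> carrier_vec n"
  have "vnorm ((A + B) *\<^sub>v v) \<le> vnorm (A *\<^sub>v v) + vnorm (B *\<^sub>v v)"
    using assms v by (auto simp: add_mult_distrib_mat_vec intro!: vnorm_add[of _ m])
  also have "\<dots> \<le> c * vnorm v + d * vnorm v"
    using assms v by (intro add_mono op_leD)
  finally show "vnorm ((A + B) *\<^sub>v v) \<le> (c + d) * vnorm v" by (simp add: algebra_simps)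
qed (use assms in auto)

lemma op_le_uminus: "op_le A c \<Longrightarrow> op_le (- A) c"
  by (simp add: op_le_def)

lemma op_le_diff:
  assumes "op_le A c" "op_le B d" "A \<in> carrier_mat m n" "B \<in> carrier_mat m n"
  shows "op_le (A - B) (c + d)"
  using op_le_add[OF assms(1) op_le_uminus[OF assms(2)], of m n] assms(3,4)
  by (simp add: add_uminus_minus_mat)

lemma op_le_mult:
  assumes "op_le A c" "op_le B d" "A \<in> carrier_mat m n" "B \<in> carrier_mat n p" "0 \<le> c"
  shows "op_le (A * B) (c * d)"
proof (rule op_leI)
  fix v :: "real vec" assume v: "v \<in> carrier_vec p"
  have "vnorm ((A * B) *\<^sub>v v) \<le> c * vnorm (B *\<^sub>v v)"
    using assms v op_leD[OF assms(1,3), of "B *\<^sub>v v"] by simp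
  also have "\<dots> \<le> c * (d * vnorm v)"
    using assms v by (intro mult_left_mono op_leD)
  finally show "vnorm ((A * B) *\<^sub>v v) \<le> c * d * vnorm v" by (simp add: mult.assoc)
qed (use assms in auto)

lemma mult_mat_vec_sum:
  "A \<in> carrier_mat m n \<Longrightarrow> v \<in> carrier_vec n \<Longrightarrow> i < m \<Longrightarrow> (A *\<^sub>v v) $ i = (\<Sum>j<n. A $$ (i, j) * v $ j)"
  for A :: "real mat"
  by (auto simp: scalar_prod_sum)

lemma smult_one_mat_mult_vec:
  "v \<in> carrier_vec n \<Longrightarrow> (c \<cdot>\<^sub>m 1\<^sub>m n) *\<^sub>v v = c \<cdot>\<^sub>v v" for c :: real
  by (intro eq_vecI) auto

lemma op_le_frobenius:
  assumes A: "A \<in> carrier_mat m n" and c: "0 \<le> c" and le: "(\<Sum>i<m. \<Sum>j<n. (A $$ (i, j))\<^sup>2) \<le> c\<^sup>2"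
  shows "op_le A c"
proof (rule op_leI[OF A])
  fix v :: "real vec" assume v: "v \<in> carrier_vec n"
  have "(vnorm (A *\<^sub>v v))\<^sup>2 = (\<Sum>i<m. (row A i \<bullet> v)\<^sup>2)"
    using A v by (subst vnorm_sq[of _ m]) auto
  also have "\<dots> \<le> (\<Sum>i<m. (vnorm (row A i) * vnorm v)\<^sup>2)"
    using A v vnorm_cauchy[of "row A _" n v] by (intro sum_mono) (auto intro!: power2_le_iff_abs_le[THEN iffD2])
  also have "\<dots> = (\<Sum>i<m. \<Sum>j<n. (A $$ (i, j))\<^sup>2) * (vnorm v)\<^sup>2"
    using A by (simp add: power_mult_distrib vnorm_sq[of "row A _" n] flip: sum_distrib_right)
  also have "\<dots> \<le> (c * vnorm v)\<^sup>2"
    using le by (auto simp: power_mult_distrib intro!: mult_right_mono)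
  finally show "vnorm (A *\<^sub>v v) \<le> c * vnorm v"
    using c by (auto intro: power2_le_imp_le)
qed

lemma spec_norm_leI:
  assumes "op_le A c" "0 \<le> c"
  shows "spec_norm A \<le> c"
  unfolding spec_norm_def
proof (rule cSUP_least)
  show "{v \<in> carrier_vec (dim_col A). v \<bullet> v \<le> (1::real)} \<noteq> {}"
    by (auto intro!: exI[of _ "0\<^sub>v (dim_col A)"])
next
  fix v :: "real vec" assume v: "v \<in> {v \<in> carrier_vec (dim_col A). v \<bullet> v \<le> 1}"
  then have "vnorm v \<le> 1" by (simp add: vnorm_sqrt)
  then have "c * vnorm v \<le> c" using \<open>0 \<le> c\<close> by (simp add: mult_left_le)
  moreover have "vnorm (A *\<^sub>v v) \<le> c * vnorm v" using assms(1) v by (auto simp: op_le_def)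
  ultimately show "sqrt ((A *\<^sub>v v) \<bullet> (A *\<^sub>v v)) \<le> c" by (simp add: vnorm_sqrt)
qed

lemma spec_norm_leD:
  assumes "spec_norm A \<le> c"
  shows "op_le A c"
proof (rule op_leI)
  show A: "A \<in> carrier_mat (dim_row A) (dim_col A)" by simp
  let ?B = "{v \<in> carrier_vec (dim_col A). v \<bullet> v \<le> (1::real)}"
  \<comment> \<open>The Frobenius bound only makes the set bounded above, without which the real
    supremum in \<open>spec_norm\<close> would bound nothing.\<close>
  define f where "f = sqrt (\<Sum>i<dim_row A. \<Sum>j<dim_col A. (A $$ (i, j))\<^sup>2)"
  have f: "op_le A f" "0 \<le> f"
    by (auto intro!: op_le_frobenius[OF A] simp: f_def sum_nonneg)
  have "bdd_above ((\<lambda>v. sqrt ((A *\<^sub>v v) \<bullet> (A *\<^sub>v v))) ` ?B)"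
  proof (rule bdd_aboveI2)
    fix v :: "real vec" assume v: "v \<in> ?B"
    then have "vnorm v \<le> 1" by (simp add: vnorm_sqrt)
    then have "f * vnorm v \<le> f" using f by (simp add: mult_left_le)
    moreover have "vnorm (A *\<^sub>v v) \<le> f * vnorm v" using f v by (auto simp: op_le_def)
    ultimately show "sqrt ((A *\<^sub>v v) \<bullet> (A *\<^sub>v v)) \<le> f" by (simp add: vnorm_sqrt)
  qed
  then have le: "vnorm (A *\<^sub>v v) \<le> c" if "v \<in> carrier_vec (dim_col A)" "vnorm v \<le> 1" for v
    using that assms cSUP_upper[of v ?B "\<lambda>v. sqrt ((A *\<^sub>v v) \<bullet> (A *\<^sub>v v))"]
    by (auto simp: spec_norm_def vnorm_sqrt)
  fix v :: "real vec" assume v: "v \<in> carrier_vec (dim_col A)"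
  show "vnorm (A *\<^sub>v v) \<le> c * vnorm v"
  proof (cases "vnorm v = 0")
    case True
    then have "v = 0\<^sub>v (dim_col A)" using v by (simp add: vnorm_eq_0)
    then show ?thesis by (simp add: vnorm_def L2_set_def)
  next
    case False
    then have pos: "vnorm v > 0" using vnorm_nonneg[of v] by linarith
    have "vnorm (A *\<^sub>v ((1 / vnorm v) \<cdot>\<^sub>v v)) \<le> c"
      using v pos by (intro le) (auto simp: vnorm_smult)
    moreover have "A *\<^sub>v ((1 / vnorm v) \<cdot>\<^sub>v v) = (1 / vnorm v) \<cdot>\<^sub>v (A *\<^sub>v v)"
      using v by (intro mult_mat_vec) auto
    ultimately show ?thesis using pos by (simp add: vnorm_smult field_simps)
  qed
qed

lemma op_le_col_sum:
  assumes "op_le A c" "A \<in> carrier_mat m n" "j < n" "0 \<le> c"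
  shows "(\<Sum>i<m. (A $$ (i, j))\<^sup>2) \<le> c\<^sup>2"
proof -
  have "vnorm (unit_vec n j) = 1" using assms by (simp add: vnorm_sqrt)
  moreover have "A *\<^sub>v unit_vec n j = col A j" using assms by (auto intro!: eq_vecI)
  ultimately have "vnorm (col A j) \<le> c"
    using op_leD[OF assms(1,2), of "unit_vec n j"] assms by simp
  then have "(vnorm (col A j))\<^sup>2 \<le> c\<^sup>2" by (intro power_mono) auto
  then show ?thesis using assms by (simp add: vnorm_sq[of _ m])
qed

lemma op_le_frobenius_sum:
  assumes "op_le A c" "A \<in> carrier_mat m n" "0 \<le> c"
  shows "(\<Sum>i<m. \<Sum>j<n. (A $$ (i, j))\<^sup>2) \<le> real n * c\<^sup>2"
  using sum_mono[of "{..<n}" "\<lambda>j. \<Sum>i<m. (A $$ (i, j))\<^sup>2" "\<lambda>_. c\<^sup>2"] op_le_col_sum[OF assms(1,2) _ assms(3)]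
  by (subst sum.swap) auto

lemma op_le_entry:
  assumes "op_le A c" "A \<in> carrier_mat m n" "i < m" "j < n" "0 \<le> c"
  shows "\<bar>A $$ (i, j)\<bar> \<le> c"
proof -
  have "(A $$ (i, j))\<^sup>2 \<le> (\<Sum>i<m. (A $$ (i, j))\<^sup>2)"
    using assms by (intro member_le_sum) auto
  also have "\<dots> \<le> c\<^sup>2" using op_le_col_sum[OF assms(1,2,4,5)] .
  finally show ?thesis using assms(5) by (simp add: power2_le_iff_abs_le)
qed

text \<open>The bound is tested on the row itself, taken as a vector \<open>u\<close>: coordinate
  \<open>i\<close> of \<open>A u\<close> is \<open>|u|^2\<close>, hence
  \<open>|u|^4 \<le> c^2 |u|^2\<close>. This avoids the norm of the transpose.\<close>

lemma op_le_row_sum: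
  assumes A: "op_le A c" "A \<in> carrier_mat m n" "i < m" "0 \<le> c"
  shows "(\<Sum>j<n. (A $$ (i, j))\<^sup>2) \<le> c\<^sup>2"
proof -
  define u where "u = row A i"
  have u: "u \<in> carrier_vec n" using A by (simp add: u_def)
  have 1: "(vnorm u)\<^sup>2 = (\<Sum>j<n. (A $$ (i, j))\<^sup>2)"
    using A by (simp add: vnorm_sq[OF u]) (simp add: u_def)
  have "(u \<bullet> u)\<^sup>2 = ((A *\<^sub>v u) $ i)\<^sup>2" using A by (simp add: u_def)
  also have "\<dots> \<le> (\<Sum>i<m. ((A *\<^sub>v u) $ i)\<^sup>2)"
    using A by (intro member_le_sum) auto
  also have "\<dots> = (vnorm (A *\<^sub>v u))\<^sup>2" using A u by (simp add: vnorm_sq[of _ m])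
  also have "\<dots> \<le> (c * vnorm u)\<^sup>2"
    using A u by (intro power_mono op_leD) auto
  finally have "((vnorm u)\<^sup>2)\<^sup>2 \<le> c\<^sup>2 * (vnorm u)\<^sup>2"
    by (simp add: vnorm_sq_scalar_prod power_mult_distrib)
  then have le: "(vnorm u)\<^sup>2 * (vnorm u)\<^sup>2 \<le> c\<^sup>2 * (vnorm u)\<^sup>2"
    by (simp add: power2_eq_square[of "(vnorm u)\<^sup>2"])
  have "(vnorm u)\<^sup>2 \<le> c\<^sup>2"
    by (rule le_of_mult_self_le[OF le]) auto
  then show ?thesis using 1 by simp
qed

lemma op_le_diagonal:
  assumes S: "S \<in> carrier_mat n n" "diagonal_mat S" and le: "\<And>i. i < n \<Longrightarrow> \<bar>S $$ (i, i)\<bar> \<le> c" "0 \<le> c"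
  shows "op_le S c"
proof (rule op_leI[OF S(1)])
  fix v :: "real vec" assume v: "v \<in> carrier_vec n"
  have "(S *\<^sub>v v) $ i = S $$ (i, i) * v $ i" if "i < n" for i
  proof -
    have "(\<Sum>j<n. S $$ (i, j) * v $ j) = (\<Sum>j<n. if j = i then S $$ (i, i) * v $ i else 0)"
      using S that by (intro sum.cong) (auto simp: diagonal_mat_def)
    then show ?thesis using that S v by (subst mult_mat_vec_sum[of _ n n]) auto
  qed
  then have "(vnorm (S *\<^sub>v v))\<^sup>2 = (\<Sum>i<n. (S $$ (i, i) * v $ i)\<^sup>2)"
    using S v by (subst vnorm_sq[of _ n]) auto
  also have "\<dots> \<le> (\<Sum>i<n. c\<^sup>2 * (v $ i)\<^sup>2)"
    using le by (intro sum_mono) (auto simp: power_mult_distrib power2_le_iff_abs_le intro!: mult_right_mono)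
  also have "\<dots> = (c * vnorm v)\<^sup>2"
    using v by (simp add: power_mult_distrib vnorm_sq[of _ n] sum_distrib_left)
  finally show "vnorm (S *\<^sub>v v) \<le> c * vnorm v"
    using le by (auto intro: power2_le_imp_le)
qed

section \<open>Inverses, full column rank and the pseudo-inverse\<close>

lemma inverse_mat_exists:
  fixes A :: "real mat"
  assumes A: "A \<in> carrier_mat n n" and inj: "\<And>v. v \<in> carrier_vec n \<Longrightarrow> A *\<^sub>v v = 0\<^sub>v n \<Longrightarrow> v = 0\<^sub>v n"
  shows "\<exists>G \<in> carrier_mat n n. A * G = 1\<^sub>m n \<and> G * A = 1\<^sub>m n"
proof -
  have "det A \<noteq> 0" using det_0_iff_vec_prod_zero_field[OF A] inj by blast
  then have "A \<in> Units (ring_mat TYPE(real) n ())" by (rule det_non_zero_imp_unit[OF A])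
  then show ?thesis by (auto simp: Units_def ring_mat_def)
qed

text \<open>Linear independence speaks of the set of columns, so repeated columns must be excluded
  first: the rank is the size of a maximal independent subset, and with a repetition there are fewer
  than \<open>n\<close> distinct columns.\<close>

lemma rank_full_inj:
  fixes A :: "real mat"
  assumes A: "A \<in> carrier_mat w n" and rk: "vec_space.rank w A = n"
    and v: "v \<in> carrier_vec n" "A *\<^sub>v v = 0\<^sub>v w"
  shows "v = 0\<^sub>v n"
proof -
  interpret V: vec_space "TYPE(real)" w .
  have dist: "distinct (cols A)"
  proof (rule ccontr)
    assume nd: "\<not> distinct (cols A)"
    obtain S where S: "maximal S (\<lambda>T. T \<subseteq> set (cols A) \<and> V.lin_indpt T)"
      using maximal_exists[of "(\<lambda>T. T \<subseteq> set (cols A) \<and> V.lin_indpt T)" "card (set (cols A))" "{}"]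
      by (meson List.finite_set card_mono empty_iff empty_subsetI V.finite_lin_indpt2 rev_finite_subset)
    then have "card S \<le> card (set (cols A))" by (simp add: card_mono maximal_def)
    also have "\<dots> < n"
      using A nd cols_length card_length[of "cols A"] card_distinct[of "cols A"] by fastforce
    finally show False using V.rank_card_indpt[OF A S] rk by simp
  qed
  show ?thesis
    using V.lin_depI[OF A v(1) _ v(2) dist] V.full_rank_lin_indpt[OF A rk dist] by blast
qed

text \<open>Makes the description in \<open>pinv\<close> proper. \<open>A B\<close> and
  \<open>A C\<close> are symmetric and \<open>A B A C = A C\<close>, \<open>A C A B = A B\<close>;
  transposing one product gives the other, so they agree. Likewise \<open>B A = C A\<close>, and
  then \<open>B = B A B = B A C = C A C = C\<close>.\<close>

lemma is_pinv_unique: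
  assumes "is_pinv A B" "is_pinv A C"
  shows "B = C"
proof -
  let ?m = "dim_row A" and ?n = "dim_col A"
  have A: "A \<in> carrier_mat ?m ?n" and B: "B \<in> carrier_mat ?n ?m" and C: "C \<in> carrier_mat ?n ?m"
    using assms by (auto simp: is_pinv_def)
  have B1: "A * B * A = A" and B2: "B * A * B = B" and B3: "transpose_mat (A * B) = A * B"
    and B4: "transpose_mat (B * A) = B * A" using assms by (auto simp: is_pinv_def)
  have C1: "A * C * A = A" and C2: "C * A * C = C" and C3: "transpose_mat (A * C) = A * C"
    and C4: "transpose_mat (C * A) = C * A" using assms by (auto simp: is_pinv_def)
  have AB: "A * B = A * C"
  proof -
    have "A * B * (A * C) = A * B * A * C"
      using A B C by (intro assoc_mult_mat[symmetric, of _ ?m ?m _ ?n _ ?m]) auto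
    then have 1: "A * B * (A * C) = A * C" using B1 by simp
    have "A * C * (A * B) = A * C * A * B"
      using A B C by (intro assoc_mult_mat[symmetric, of _ ?m ?m _ ?n _ ?m]) auto
    then have 2: "A * C * (A * B) = A * B" using C1 by simp
    have "transpose_mat (A * B * (A * C)) = transpose_mat (A * C) * transpose_mat (A * B)"
      using A B C by (intro transpose_mult[of _ ?m ?m _ ?m]) auto
    then show ?thesis using 1 2 B3 C3 by simp
  qed
  have BA: "B * A = C * A"
  proof -
    have "C * A * (B * A) = C * (A * (B * A))"
      using A B C by (intro assoc_mult_mat[of _ ?n ?m _ ?n _ ?n]) auto
    also have "A * (B * A) = A"
      using B1 assoc_mult_mat[OF A B A] by simp
    finally have 1: "C * A * (B * A) = C * A" .
    have "B * A * (C * A) = B * (A * (C * A))"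
      using A B C by (intro assoc_mult_mat[of _ ?n ?m _ ?n _ ?n]) auto
    also have "A * (C * A) = A"
      using C1 assoc_mult_mat[OF A C A] by simp
    finally have 2: "B * A * (C * A) = B * A" .
    have "transpose_mat (C * A * (B * A)) = transpose_mat (B * A) * transpose_mat (C * A)"
      using A B C by (intro transpose_mult[of _ ?n ?n _ ?n]) auto
    then show ?thesis using 1 2 B4 C4 by simp
  qed
  have "B = B * (A * C)" using B2 assoc_mult_mat[OF B A B] AB by simp
  also have "\<dots> = C" using C2 assoc_mult_mat[OF B A C] BA by simp
  finally show ?thesis .
qed

text \<open>Injectivity of \<open>A\<close> makes the Gram matrix \<open>H\<close> invertible, since
  \<open>|A v|^2 = (H v) \<bullet> v\<close>; the matrix \<open>H^-1 A^T\<close> satisfies the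
  Penrose equations and is a left inverse.\<close>

lemma pinv_left_inverse:
  assumes A: "A \<in> carrier_mat m n" and inj: "\<And>v. v \<in> carrier_vec n \<Longrightarrow> A *\<^sub>v v = 0\<^sub>v m \<Longrightarrow> v = 0\<^sub>v n"
  shows "pinv A \<in> carrier_mat n m" "pinv A * A = 1\<^sub>m n"
proof -
  let ?At = "transpose_mat A"
  have At: "?At \<in> carrier_mat n m" using A by simp
  define H where "H = ?At * A"
  have H: "H \<in> carrier_mat n n" using A At by (simp add: H_def)
  have tH: "transpose_mat H = H" using transpose_mult[OF At A] by (simp add: H_def)
  have "\<exists>G \<in> carrier_mat n n. H * G = 1\<^sub>m n \<and> G * H = 1\<^sub>m n"
  proof (rule inverse_mat_exists[OF H])
    fix v assume v: "v \<in> carrier_vec n" and 0: "H *\<^sub>v v = 0\<^sub>v n"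
    have Av: "A *\<^sub>v v \<in> carrier_vec m" using A v by simp
    have "(vnorm (A *\<^sub>v v))\<^sup>2 = (?At *\<^sub>v (A *\<^sub>v v)) \<bullet> v"
      using transpose_vec_mult_scalar[OF A v Av] by (simp add: vnorm_sq_scalar_prod)
    also have "?At *\<^sub>v (A *\<^sub>v v) = H *\<^sub>v v"
      unfolding H_def using assoc_mult_mat_vec[OF At A v] by simp
    finally have "vnorm (A *\<^sub>v v) = 0" using 0 v by simp
    then have "A *\<^sub>v v = 0\<^sub>v m" using vnorm_eq_0[OF Av] by simp
    then show "v = 0\<^sub>v n" by (rule inj[OF v])
  qed
  then obtain G where G: "G \<in> carrier_mat n n" and HG: "H * G = 1\<^sub>m n" and GH: "G * H = 1\<^sub>m n"
    by blast
  have tGc: "transpose_mat G \<in> carrier_mat n n" using G by simp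
  have "transpose_mat G * H = 1\<^sub>m n"
    using arg_cong[OF HG, of transpose_mat] transpose_mult[OF H G] tH by simp
  then have tG: "transpose_mat G = G"
    using assoc_mult_mat[OF tGc H G] HG G by simp
  define B where "B = G * ?At"
  have B: "B \<in> carrier_mat n m" using G At by (simp add: B_def)
  have BA: "B * A = 1\<^sub>m n" unfolding B_def using assoc_mult_mat[OF G At A] GH by (simp add: H_def)
  have tB: "transpose_mat B = A * G"
    unfolding B_def using transpose_mult[OF G At] tG by simp
  have "transpose_mat (A * B) = A * B"
    using transpose_mult[OF A B] tB assoc_mult_mat[OF A G At] by (simp add: B_def)
  moreover have "A * B * A = A" using assoc_mult_mat[OF A B A] BA A by simp
  ultimately have pin: "is_pinv A B"
    using A B BA by (simp add: is_pinv_def)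
  then have eq: "pinv A = B"
    unfolding pinv_def by (rule the_equality) (rule is_pinv_unique[OF _ pin])
  show "pinv A \<in> carrier_mat n m" "pinv A * A = 1\<^sub>m n" using eq B BA by auto
qed

section \<open>Expectations under the correlation conditions\<close>

text \<open>Binary vectors of fixed dimension have finite support, and so have the laws of the
  iterates built from them. All integrability conditions disappear, and the locale serves for both
  kinds of law.\<close>

locale finite_pmf =
  fixes \<mu> :: "'a pmf"
  assumes finite_support: "finite (set_pmf \<mu>)"
begin

abbreviation E :: "('a \<Rightarrow> real) \<Rightarrow> real" where
  "E f \<equiv> measure_pmf.expectation \<mu> f"

lemma integrable [simp, intro]: "integrable (measure_pmf \<mu>) (f :: 'a \<Rightarrow> real)"
  by (rule integrable_measure_pmf_finite[OF finite_support])

lemma E_eq_sum: "E f = (\<Sum>x\<in>set_pmf \<mu>. pmf \<mu> x * f x)"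
  by (subst integral_measure_pmf_real[OF finite_support]) (auto simp: mult.commute)

lemma E_sum: "E (\<lambda>x. \<Sum>i\<in>I. f i x) = (\<Sum>i\<in>I. E (f i))"
  by (rule Bochner_Integration.integral_sum) simp

lemma E_mono: "(\<And>x. x \<in> set_pmf \<mu> \<Longrightarrow> f x \<le> g x) \<Longrightarrow> E f \<le> E g"
  by (auto simp: E_eq_sum intro!: sum_mono mult_left_mono)

lemma E_cong: "(\<And>x. x \<in> set_pmf \<mu> \<Longrightarrow> f x = g x) \<Longrightarrow> E f = E g"
  by (simp add: E_eq_sum)

lemma E_nonneg: "(\<And>x. x \<in> set_pmf \<mu> \<Longrightarrow> 0 \<le> f x) \<Longrightarrow> 0 \<le> E f"
  by (auto simp: E_eq_sum intro!: sum_nonneg)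

lemma E_cauchy: "(E (\<lambda>x. f x * g x))\<^sup>2 \<le> E (\<lambda>x. (f x)\<^sup>2) * E (\<lambda>x. (g x)\<^sup>2)"
proof -
  have "E (\<lambda>x. f x * g x) = (\<Sum>x\<in>set_pmf \<mu>. (sqrt (pmf \<mu> x) * f x) * (sqrt (pmf \<mu> x) * g x))"
    unfolding E_eq_sum by (intro sum.cong) (simp_all add: algebra_simps)
  then have "(E (\<lambda>x. f x * g x))\<^sup>2 \<le> (\<Sum>x\<in>set_pmf \<mu>. (sqrt (pmf \<mu> x) * f x)\<^sup>2) * (\<Sum>x\<in>set_pmf \<mu>. (sqrt (pmf \<mu> x) * g x)\<^sup>2)"
    using Cauchy_Schwarz_ineq_sum by metis
  also have "\<dots> = E (\<lambda>x. (f x)\<^sup>2) * E (\<lambda>x. (g x)\<^sup>2)"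
    unfolding E_eq_sum by (simp add: power_mult_distrib)
  finally show ?thesis .
qed

end

locale binary_gcc =
  fixes D :: nat and r k m lam :: real and \<mu> :: "real vec pmf"
  assumes D_pos: "0 < D" and k_pos: "0 < k" and lam_pos: "0 < lam" and m_nonneg: "0 \<le> m"
    and binary: "\<And>x. x \<in> set_pmf \<mu> \<Longrightarrow> x \<in> carrier_vec D \<and> (\<forall>i<D. x $ i \<in> {0, 1})"
    and gcc: "gcc D r k m lam \<mu>"
begin

sublocale finite_pmf \<mu>
proof
  have "set_pmf \<mu> \<subseteq> vec_of_list ` {xs. set xs \<subseteq> {0, 1} \<and> length xs = D}"
  proof
    fix x assume "x \<in> set_pmf \<mu>"
    with binary have x: "x \<in> carrier_vec D" "\<forall>i<D. x $ i \<in> {0, 1}" by auto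
    then have "set (list_of_vec x) \<subseteq> {0, 1}"
      by (auto simp: in_set_conv_nth list_of_vec_index)
    then show "x \<in> vec_of_list ` {xs. set xs \<subseteq> {0, 1} \<and> length xs = D}"
      using x by (intro image_eqI[of _ _ "list_of_vec x"]) (auto simp: vec_list)
  qed
  then show "finite (set_pmf \<mu>)"
    by (rule finite_subset) (intro finite_imageI finite_lists_length_eq, simp)
qed

lemma x_cases: "x \<in> set_pmf \<mu> \<Longrightarrow> i < D \<Longrightarrow> x $ i = 0 \<or> x $ i = 1"
  using binary by auto

lemma x_dim: "x \<in> set_pmf \<mu> \<Longrightarrow> x \<in> carrier_vec D"
  using binary by auto

lemma x_nonneg: "x \<in> set_pmf \<mu> \<Longrightarrow> i < D \<Longrightarrow> 0 \<le> x $ i"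
  using x_cases by fastforce

lemma x_sq: "x \<in> set_pmf \<mu> \<Longrightarrow> i < D \<Longrightarrow> (x $ i)\<^sup>2 = x $ i"
  using x_cases by fastforce

lemma x_sum_le: "x \<in> set_pmf \<mu> \<Longrightarrow> (\<Sum>i<D. x $ i) \<le> r"
proof -
  assume x: "x \<in> set_pmf \<mu>"
  then have "(\<Sum>i<D. x $ i) = (\<Sum>i<D. \<bar>x $ i\<bar>)" by (intro sum.cong) (auto simp: x_nonneg)
  then show ?thesis using gcc x by (auto simp: gcc_def)
qed

lemma E_x_le: "i < D \<Longrightarrow> E (\<lambda>x. x $ i) \<le> 2 * k / D"
proof -
  assume i: "i < D"
  have "E (\<lambda>x. x $ i * x $ i) \<le> 2 * k / D"
    using gcc i by (auto simp: gcc_def second_moment_def)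
  also have "E (\<lambda>x. x $ i * x $ i) = E (\<lambda>x. x $ i)"
    using i x_sq by (intro E_cong) (auto simp: power2_eq_square)
  finally show ?thesis .
qed

lemma E_xx_le: "i < D \<Longrightarrow> j < D \<Longrightarrow> i \<noteq> j \<Longrightarrow> E (\<lambda>x. x $ i * x $ j) \<le> m / (real D)\<^sup>2"
  using gcc by (auto simp: gcc_def second_moment_def)

lemma E_lin_ge: "k * lam / D * (\<Sum>i<D. (u i)\<^sup>2) \<le> E (\<lambda>x. (\<Sum>i<D. u i * x $ i)\<^sup>2)"
proof -
  define v where "v = vec D u"
  define M where "M = second_moment D \<mu>"
  have M: "M \<in> carrier_mat D D" by (simp add: M_def second_moment_def)
  have v: "v \<in> carrier_vec D" by (simp add: v_def)
  have "psd (M - (k / real D * lam) \<cdot>\<^sub>m 1\<^sub>m D)"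
    using gcc by (auto simp: gcc_def loewner_ge_def M_def)
  then have "0 \<le> v \<bullet> ((M - (k / real D * lam) \<cdot>\<^sub>m 1\<^sub>m D) *\<^sub>v v)"
    using M v by (auto simp: psd_def)
  also have "(M - (k / real D * lam) \<cdot>\<^sub>m 1\<^sub>m D) *\<^sub>v v = M *\<^sub>v v - (k * lam / D) \<cdot>\<^sub>v v"
    using M v by (simp add: minus_mult_distrib_mat_vec[of _ D D] smult_one_mat_mult_vec)
  also have "v \<bullet> \<dots> = v \<bullet> (M *\<^sub>v v) - k * lam / D * (v \<bullet> v)"
    using M v by (simp add: scalar_prod_minus_distrib[of _ D])
  finally have "k * lam / D * (v \<bullet> v) \<le> v \<bullet> (M *\<^sub>v v)" by simp
  also have "v \<bullet> v = (\<Sum>i<D. (u i)\<^sup>2)"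
    by (simp add: v_def scalar_prod_sum[of _ D] power2_eq_square)
  also have "v \<bullet> (M *\<^sub>v v) = (\<Sum>i<D. u i * (\<Sum>j<D. E (\<lambda>x. x $ i * x $ j) * u j))"
    using mult_mat_vec_sum[OF M v]
    by (subst scalar_prod_sum[OF mult_mat_vec_carrier[OF M v]])
       (auto simp: v_def second_moment_def M_def simp del: index_mult_mat_vec intro!: sum.cong)
  also have "\<dots> = E (\<lambda>x. (\<Sum>i<D. u i * x $ i)\<^sup>2)"
    by (simp add: power2_eq_square sum_product E_sum sum_distrib_left algebra_simps)
  finally show ?thesis .
qed

lemma E_x_ge: "i < D \<Longrightarrow> k * lam / D \<le> E (\<lambda>x. x $ i)"
proof -
  assume i: "i < D"
  have eq: "(\<Sum>j<D. (if j = i then 1 else 0) * x $ j) = x $ i" for x :: "real vec"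
    using i by (simp add: if_distrib[of "\<lambda>a. a * _"] cong: if_cong)
  have "k * lam / D \<le> E (\<lambda>x. (x $ i)\<^sup>2)"
    using E_lin_ge[of "\<lambda>j. if j = i then 1 else 0"] i by (simp add: eq if_distrib[of "\<lambda>a. a ^ 2"] cong: if_cong)
  also have "\<dots> = E (\<lambda>x. x $ i)" using i x_sq by (intro E_cong) auto
  finally show ?thesis .
qed

lemma lam_le_2: "lam \<le> 2"
proof -
  have "k * lam / D \<le> 2 * k / D" using E_x_ge[OF D_pos] E_x_le[OF D_pos] by simp
  then show ?thesis using D_pos k_pos by (simp add: field_simps)
qed

lemma k_lam_le: "k * lam / D \<le> 1"
proof -
  have "E (\<lambda>x. x $ 0) \<le> E (\<lambda>x. 1)" using x_cases[OF _ D_pos] by (intro E_mono) fastforce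
  then show ?thesis using E_x_ge[OF D_pos] by simp
qed

text \<open>A binary vector whose entries sum to less than 1 is zero, which contradicts the positive
  lower bound \<open>E_x_ge\<close>.\<close>

lemma r_ge_1: "1 \<le> r"
proof (rule ccontr)
  assume r: "\<not> 1 \<le> r"
  have "x $ 0 = 0" if x: "x \<in> set_pmf \<mu>" for x
  proof -
    have "x $ 0 \<le> (\<Sum>i<D. x $ i)"
      using D_pos x x_nonneg by (intro member_le_sum) auto
    then show ?thesis using x_cases[OF x D_pos] x_sum_le[OF x] r by auto
  qed
  then have "E (\<lambda>x. x $ 0) = E (\<lambda>x. 0)" by (intro E_cong) auto
  moreover have "0 < k * lam / D" using D_pos k_pos lam_pos by simp
  ultimately show False using E_x_ge[OF D_pos] by simp
qed

end

section \<open>The decoding error\<close>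

definition off_part :: "real mat \<Rightarrow> real mat" where
  "off_part A = mat (dim_row A) (dim_col A) (\<lambda>(i, j). if i = j then 0 else A $$ (i, j))"

text \<open>\<open>G\<close> is the inverse of the factor with which a stage starts;
  \<open>decoding_inverse\<close> supplies these assumptions with \<open>e = 12 d\<close>. The lower
  bound \<open>1/2\<close> on the diagonal is twice the threshold: an active coordinate is cut off
  only if the other coordinates contribute less than \<open>-1/4\<close>.\<close>

locale decoding = binary_gcc +
  fixes G :: "real mat" and e :: real
  assumes G: "G \<in> carrier_mat D D"
    and G_diag: "\<And>i. i < D \<Longrightarrow> 1 / 2 \<le> G $$ (i, i) \<and> G $$ (i, i) \<le> 3"
    and off: "op_le (off_part G) e" and e_nonneg: "0 \<le> e" and e_le: "e \<le> 1 / 16"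
    and m_le: "m \<le> 1 / (2 * 10 ^ 20) * (k * real D * lam ^ 4 / r ^ 5)"
begin

definition h :: "real vec \<Rightarrow> nat \<Rightarrow> real" where
  "h x i = (\<Sum>l<D. off_part G $$ (i, l) * x $ l)"

definition z :: "real vec \<Rightarrow> real vec" where
  "z x = thresh (1 / 4) (G *\<^sub>v x)"

definition b :: "real vec \<Rightarrow> nat \<Rightarrow> real" where
  "b x i = z x $ i - G $$ (i, i) * x $ i"

text \<open>The false positives: at a coordinate with \<open>x $ i = 0\<close> this is the whole
  code.\<close>

definition a :: "real vec \<Rightarrow> nat \<Rightarrow> real" where
  "a x i = (if 1 / 4 \<le> h x i then h x i else 0)"

lemma off_carrier: "off_part G \<in> carrier_mat D D"
  using G by (simp add: off_part_def)

lemma z_dim: "z x \<in> carrier_vec D"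
  using G by (intro carrier_vecI) (simp add: z_def thresh_def)

lemma z_nth:
  assumes "x \<in> carrier_vec D" "i < D"
  shows "z x $ i = (if 1 / 4 \<le> G $$ (i, i) * x $ i + h x i then G $$ (i, i) * x $ i + h x i else 0)"
proof -
  have "(G *\<^sub>v x) $ i = (\<Sum>l<D. G $$ (i, l) * x $ l)"
    using G assms by (rule mult_mat_vec_sum)
  also have "\<dots> = G $$ (i, i) * x $ i + (\<Sum>l\<in>{..<D} - {i}. G $$ (i, l) * x $ l)"
    using assms by (intro sum.remove) auto
  also have "(\<Sum>l\<in>{..<D} - {i}. G $$ (i, l) * x $ l) = (\<Sum>l\<in>{..<D} - {i}. off_part G $$ (i, l) * x $ l)"
    using G assms by (intro sum.cong) (auto simp: off_part_def)
  also have "\<dots> = off_part G $$ (i, i) * x $ i + \<dots>"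
    using G assms by (simp add: off_part_def)
  also have "\<dots> = h x i"
    unfolding h_def using assms by (intro sum.remove[symmetric]) auto
  finally show ?thesis using G assms by (simp add: z_def thresh_def)
qed

text \<open>Thresholding never enlarges an entry, and \<open>|x|^2 \<le> D\<close> for binary
  \<open>x\<close>. The crude factor \<open>D\<close> costs only a polynomial factor in the step
  size.\<close>

lemma z_sq_sum_le:
  assumes "op_le G c" "0 \<le> c" "x \<in> set_pmf \<mu>"
  shows "(\<Sum>i<D. (z x $ i)\<^sup>2) \<le> c\<^sup>2 * D"
proof -
  have x: "x \<in> carrier_vec D" using assms x_dim by auto
  have "(\<Sum>i<D. (z x $ i)\<^sup>2) \<le> (\<Sum>i<D. ((G *\<^sub>v x) $ i)\<^sup>2)"
    using G by (intro sum_mono) (auto simp: z_def thresh_def)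
  also have "\<dots> = (vnorm (G *\<^sub>v x))\<^sup>2" using G x by (simp add: vnorm_sq[of _ D])
  also have "\<dots> \<le> (c * vnorm x)\<^sup>2" using assms G x by (intro power_mono op_leD) auto
  also have "\<dots> = c\<^sup>2 * (\<Sum>i<D. (x $ i)\<^sup>2)" using x by (simp add: power_mult_distrib vnorm_sq)
  also have "\<dots> \<le> c\<^sup>2 * (\<Sum>i<D. 1)"
    using x_cases[OF assms(3)] by (intro mult_left_mono sum_mono) fastforce+
  finally show ?thesis by simp
qed

text \<open>At an inactive coordinate the error is \<open>a\<close>. At an active one it is
  \<open>h\<close> if the entry survives. If it is cut, the error has size \<open>G_ii\<close>; from
  \<open>G_ii + h < 1/4\<close> and \<open>G_ii \<ge> 1/2\<close> follow \<open>-h > 1/4\<close> and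
  \<open>G_ii < 1/4 + |h| \<le> 2 |h|\<close>, which explains the factor 2.\<close>

lemma b_abs_le:
  assumes "x \<in> set_pmf \<mu>" "i < D"
  shows "\<bar>b x i\<bar> \<le> 2 * (x $ i * \<bar>h x i\<bar>) + a x i"
  using x_cases[OF assms]
proof
  assume "x $ i = 0"
  then show ?thesis using assms x_dim by (auto simp: b_def z_nth a_def)
next
  assume "x $ i = 1"
  then show ?thesis using assms x_dim G_diag[of i] by (auto simp: b_def z_nth a_def)
qed

lemma h_sq_sum:
  assumes "x \<in> set_pmf \<mu>"
  shows "(\<Sum>i<D. (h x i)\<^sup>2) \<le> e\<^sup>2 * r"
proof -
  have x: "x \<in> carrier_vec D" using assms x_dim by auto
  have "(\<Sum>i<D. (h x i)\<^sup>2) = (vnorm (off_part G *\<^sub>v x))\<^sup>2"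
    using off_carrier x by (simp add: vnorm_sq[of _ D] h_def mult_mat_vec_sum[of _ D D] del: index_mult_mat_vec)
  also have "\<dots> \<le> (e * vnorm x)\<^sup>2"
    using off off_carrier x by (intro power_mono op_leD) auto
  also have "\<dots> = e\<^sup>2 * (\<Sum>i<D. x $ i)"
    using x x_sq[OF assms] by (simp add: power_mult_distrib vnorm_sq)
  also have "\<dots> \<le> e\<^sup>2 * r" using x_sum_le[OF assms] by (intro mult_left_mono) auto
  finally show ?thesis .
qed

text \<open>The sure factor of the Schur test. At active coordinates, of which there are at most
  \<open>r\<close>, Cauchy-Schwarz gives \<open>r e\<close>. False positives may spread over all
  \<open>D\<close> coordinates, but above the threshold \<open>a \<le> 4 h^2\<close>, so their sum
  is at most \<open>4 e^2 r \<le> r e\<close>.\<close>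

lemma b_abs_sum:
  assumes "x \<in> set_pmf \<mu>"
  shows "(\<Sum>i<D. \<bar>b x i\<bar>) \<le> 3 * r * e"
proof -
  have "(\<Sum>i<D. x $ i * \<bar>h x i\<bar>)\<^sup>2 \<le> (\<Sum>i<D. (x $ i)\<^sup>2) * (\<Sum>i<D. \<bar>h x i\<bar>\<^sup>2)"
    by (rule Cauchy_Schwarz_ineq_sum)
  also have "\<dots> \<le> r * (e\<^sup>2 * r)"
    using x_sum_le[OF assms] h_sq_sum[OF assms] x_sq[OF assms] r_ge_1
    by (intro mult_mono) (auto intro: sum_nonneg)
  also have "\<dots> = (r * e)\<^sup>2" by (simp add: power2_eq_square)
  finally have 1: "(\<Sum>i<D. x $ i * \<bar>h x i\<bar>) \<le> r * e"
    using r_ge_1 e_nonneg by (auto intro: power2_le_imp_le)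
  have "(\<Sum>i<D. a x i) \<le> (\<Sum>i<D. 4 * (h x i)\<^sup>2)"
  proof (rule sum_mono)
    fix i
    show "a x i \<le> 4 * (h x i)\<^sup>2"
    proof (cases "1 / 4 \<le> h x i")
      case True
      then have "1 / 4 * h x i \<le> h x i * h x i" by (intro mult_right_mono) auto
      then show ?thesis using True by (simp add: a_def power2_eq_square)
    qed (simp add: a_def)
  qed
  also have "\<dots> \<le> 4 * (e\<^sup>2 * r)" using h_sq_sum[OF assms] by (simp flip: sum_distrib_left)
  also have "\<dots> = (4 * e) * (r * e)" by (simp add: power2_eq_square)
  also have "\<dots> \<le> 1 * (r * e)" using e_le e_nonneg r_ge_1 by (intro mult_right_mono) auto
  finally have 2: "(\<Sum>i<D. a x i) \<le> r * e" by simp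
  have "(\<Sum>i<D. \<bar>b x i\<bar>) \<le> (\<Sum>i<D. 2 * (x $ i * \<bar>h x i\<bar>) + a x i)"
    using b_abs_le[OF assms] by (intro sum_mono) auto
  also have "\<dots> = 2 * (\<Sum>i<D. x $ i * \<bar>h x i\<bar>) + (\<Sum>i<D. a x i)"
    by (simp add: sum.distrib sum_distrib_left)
  also have "\<dots> \<le> 3 * r * e" using 1 2 by simp
  finally show ?thesis .
qed

lemma off_row_sum: "i < D \<Longrightarrow> (\<Sum>l<D. (off_part G $$ (i, l))\<^sup>2) \<le> e\<^sup>2"
  by (rule op_le_row_sum[OF off off_carrier _ e_nonneg])

text \<open>Cauchy-Schwarz with weights \<open>x_l\<close>, of total at most \<open>r\<close>, keeps
  a factor \<open>x_l\<close> beside each squared entry. The vanishing diagonal of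
  \<open>off_part G\<close> leaves only products \<open>x_i x_l\<close> with
  \<open>l \<noteq> i\<close>, to which condition (3) applies.\<close>

lemma E_x_h_sq:
  assumes i: "i < D"
  shows "E (\<lambda>x. x $ i * (h x i)\<^sup>2) \<le> r * e\<^sup>2 * m / (real D)\<^sup>2"
proof -
  let ?o = "\<lambda>l. off_part G $$ (i, l)"
  have "E (\<lambda>x. x $ i * (h x i)\<^sup>2) \<le> E (\<lambda>x. \<Sum>l<D. r * (?o l)\<^sup>2 * (x $ i * x $ l))"
  proof (rule E_mono)
    fix x assume x: "x \<in> set_pmf \<mu>"
    have "(h x i)\<^sup>2 = (\<Sum>l<D. x $ l * (?o l * x $ l))\<^sup>2"
      unfolding h_def using x_sq[OF x] by (intro arg_cong[where f = "\<lambda>a. a\<^sup>2"] sum.cong) (auto simp: power2_eq_square)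
    also have "\<dots> \<le> (\<Sum>l<D. (x $ l)\<^sup>2) * (\<Sum>l<D. (?o l * x $ l)\<^sup>2)"
      by (rule Cauchy_Schwarz_ineq_sum)
    also have "\<dots> = (\<Sum>l<D. x $ l) * (\<Sum>l<D. (?o l)\<^sup>2 * x $ l)"
      using x_sq[OF x] by (simp add: power_mult_distrib)
    also have "\<dots> \<le> r * (\<Sum>l<D. (?o l)\<^sup>2 * x $ l)"
      using x_sum_le[OF x] x_nonneg[OF x] by (intro mult_right_mono) (auto intro!: sum_nonneg)
    finally have "x $ i * (h x i)\<^sup>2 \<le> x $ i * (r * (\<Sum>l<D. (?o l)\<^sup>2 * x $ l))"
      using x_nonneg[OF x i] by (intro mult_left_mono)
    then show "x $ i * (h x i)\<^sup>2 \<le> (\<Sum>l<D. r * (?o l)\<^sup>2 * (x $ i * x $ l))"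
      by (simp add: sum_distrib_left algebra_simps)
  qed
  also have "\<dots> = (\<Sum>l<D. r * (?o l)\<^sup>2 * E (\<lambda>x. x $ i * x $ l))"
    by (simp add: E_sum)
  also have "\<dots> \<le> (\<Sum>l<D. r * (?o l)\<^sup>2 * (m / (real D)\<^sup>2))"
  proof (rule sum_mono)
    fix l assume l: "l \<in> {..<D}"
    show "r * (?o l)\<^sup>2 * E (\<lambda>x. x $ i * x $ l) \<le> r * (?o l)\<^sup>2 * (m / (real D)\<^sup>2)"
    proof (cases "l = i")
      case True
      then show ?thesis using i G by (simp add: off_part_def)
    next
      case False
      then show ?thesis using i l r_ge_1 by (intro mult_left_mono E_xx_le) auto
    qed
  qed
  also have "\<dots> = r * (m / (real D)\<^sup>2) * (\<Sum>l<D. (?o l)\<^sup>2)"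
    by (simp add: sum_distrib_left algebra_simps)
  also have "\<dots> \<le> r * (m / (real D)\<^sup>2) * e\<^sup>2"
    using off_row_sum[OF i] r_ge_1 m_nonneg by (intro mult_left_mono) auto
  finally show ?thesis by (simp add: algebra_simps)
qed

lemma E_x_h:
  assumes i: "i < D"
  shows "E (\<lambda>x. x $ i * \<bar>h x i\<bar>) \<le> 2 / 10 ^ 10 * (e * (k * lam / (r * D)))"
proof -
  have r: "0 < r" using r_ge_1 by simp
  \<comment> \<open>Since \<open>x $ i\<close> is idempotent it can appear in both factors of
    Cauchy-Schwarz; the first then contributes the small probability \<open>2 k / D\<close> instead
    of 1.\<close>
  have "E (\<lambda>x. x $ i * \<bar>h x i\<bar>) = E (\<lambda>x. x $ i * (x $ i * \<bar>h x i\<bar>))"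
    using x_sq i by (intro E_cong) (auto simp: power2_eq_square simp flip: mult.assoc)
  then have "(E (\<lambda>x. x $ i * \<bar>h x i\<bar>))\<^sup>2 \<le> E (\<lambda>x. (x $ i)\<^sup>2) * E (\<lambda>x. (x $ i * \<bar>h x i\<bar>)\<^sup>2)"
    using E_cauchy[of "\<lambda>x. x $ i" "\<lambda>x. x $ i * \<bar>h x i\<bar>"] by simp
  also have "E (\<lambda>x. (x $ i)\<^sup>2) = E (\<lambda>x. x $ i)" using x_sq i by (intro E_cong) auto
  also have "E (\<lambda>x. (x $ i * \<bar>h x i\<bar>)\<^sup>2) = E (\<lambda>x. x $ i * (h x i)\<^sup>2)"
    using x_sq i by (intro E_cong) (auto simp: power_mult_distrib)
  also have "E (\<lambda>x. x $ i) * E (\<lambda>x. x $ i * (h x i)\<^sup>2) \<le> (2 * k / D) * (r * e\<^sup>2 * m / (real D)\<^sup>2)"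
    using E_x_le[OF i] E_x_h_sq[OF i] k_pos x_nonneg i by (intro mult_mono E_nonneg) auto
  also have "\<dots> = 2 * k * r * e\<^sup>2 / real D ^ 3 * m" by (simp add: power2_eq_square power3_eq_cube)
  also have "\<dots> \<le> 2 * k * r * e\<^sup>2 / real D ^ 3 * (1 / (2 * 10 ^ 20) * (k * real D * lam ^ 4 / r ^ 5))"
    using m_le k_pos r by (intro mult_left_mono) auto
  \<comment> \<open>Here the bound on \<open>m\<close> becomes a perfect square: its factor
    \<open>1 / (2 * 10 ^ 20)\<close> cancels the 2 of condition (2).\<close>
  also have "\<dots> = (1 / 10 ^ 10 * (e * (k * lam ^ 2 / (r ^ 2 * D))))\<^sup>2"
    using D_pos r by (simp add: field_simps power_numeral_reduce)
  finally have "E (\<lambda>x. x $ i * \<bar>h x i\<bar>) \<le> 1 / 10 ^ 10 * (e * (k * lam ^ 2 / (r ^ 2 * D)))"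
    using e_nonneg k_pos by (auto intro: power2_le_imp_le)
  moreover have "k * lam ^ 2 / (r ^ 2 * D) \<le> 2 * (k * lam / (r * D))"
  proof -
    have "k * lam ^ 2 / (r ^ 2 * D) = k * lam / (r * D) * (lam / r)" by (simp add: power2_eq_square mult_ac)
    also have "\<dots> \<le> k * lam / (r * D) * 2"
      using lam_le_2 r_ge_1 lam_pos k_pos by (intro mult_left_mono) (auto simp: field_simps)
    finally show ?thesis by (simp add: mult_ac)
  qed
  ultimately have "E (\<lambda>x. x $ i * \<bar>h x i\<bar>) \<le> 1 / 10 ^ 10 * (e * (2 * (k * lam / (r * D))))"
    using e_nonneg by (elim order_trans) (intro mult_left_mono, auto)
  then show ?thesis by simp
qed

lemma E_a:
  assumes i: "i < D"
  shows "E (\<lambda>x. a x i) \<le> 1 / 10 ^ 10 * (e * (k * lam / (r * D)))"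
proof -
  have r: "0 < r" using r_ge_1 by simp
  \<comment> \<open>Entries below \<open>1 / (8 r)\<close> contribute at most \<open>1 / 8\<close> to \<open>h x i\<close>; keeping only the large ones
    bounds their sum by \<open>8 r e\<^sup>2\<close> instead of \<open>\<surd>D e\<close>, which gains a factor \<open>D\<close>.\<close>
  define p where "p l = (if 1 / (8 * r) \<le> \<bar>off_part G $$ (i, l)\<bar> then \<bar>off_part G $$ (i, l)\<bar> else 0)" for l
  have p0: "0 \<le> p l" for l by (simp add: p_def)
  have pe: "p l \<le> 1 / 16" if "l < D" for l
    using op_le_entry[OF off off_carrier i that e_nonneg] e_le by (auto simp: p_def)
  have psq: "p l \<le> 8 * r * (off_part G $$ (i, l))\<^sup>2" for l
  proof (cases "1 / (8 * r) \<le> \<bar>off_part G $$ (i, l)\<bar>")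
    case True
    then have "1 \<le> 8 * r * \<bar>off_part G $$ (i, l)\<bar>" using r by (simp add: field_simps)
    then have "1 * \<bar>off_part G $$ (i, l)\<bar> \<le> (8 * r * \<bar>off_part G $$ (i, l)\<bar>) * \<bar>off_part G $$ (i, l)\<bar>"
      by (intro mult_right_mono) auto
    then show ?thesis using True by (simp add: p_def power2_eq_square mult.assoc)
  qed (use r in \<open>simp add: p_def\<close>)
  let ?c = "\<lambda>x l l'. if l = l' then 0 else p l * p l' * (x $ l * x $ l')"
  \<comment> \<open>If \<open>h \<ge> 1/4\<close>, the large entries contribute
    \<open>H \<ge> 1/8\<close>. Single terms are at most \<open>1/16\<close>, so the diagonal of
    \<open>H^2\<close> is at most \<open>H/16\<close>, and pairs of distinct active coordinates
    account for at least \<open>H/8 - H/16 = H/16\<close>. As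
    \<open>h \<le> H + 1/8 \<le> 2 H\<close>, the factor is 32.\<close>
  have "E (\<lambda>x. a x i) \<le> E (\<lambda>x. 32 * (\<Sum>l<D. \<Sum>l'<D. ?c x l l'))"
  proof (rule E_mono)
    fix x assume x: "x \<in> set_pmf \<mu>"
    show "a x i \<le> 32 * (\<Sum>l<D. \<Sum>l'<D. ?c x l l')"
    proof (cases "1 / 4 \<le> h x i")
      case False
      have "0 \<le> (\<Sum>l<D. \<Sum>l'<D. ?c x l l')"
        using x_nonneg[OF x] p0 by (intro sum_nonneg) auto
      then show ?thesis using False by (simp add: a_def)
    next
      case True
      define H where "H = (\<Sum>l<D. p l * x $ l)"
      have "h x i \<le> (\<Sum>l<D. p l * x $ l + 1 / (8 * r) * x $ l)"
        unfolding h_def distrib_right[symmetric] using x_nonneg[OF x] r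
        by (intro sum_mono mult_right_mono) (auto simp: p_def not_le intro: order_trans[OF abs_ge_self] add_increasing2)
      also have "\<dots> = H + 1 / (8 * r) * (\<Sum>l<D. x $ l)"
        by (simp add: H_def sum.distrib sum_distrib_left)
      also have "\<dots> \<le> H + 1 / (8 * r) * r"
        using x_sum_le[OF x] r by (intro add_left_mono mult_left_mono) auto
      finally have hH: "h x i \<le> H + 1 / 8" using r by simp
      then have H: "1 / 8 \<le> H" using True by simp
      have HH: "H * H = (\<Sum>l<D. \<Sum>l'<D. p l * p l' * (x $ l * x $ l'))"
        by (simp add: H_def sum_product algebra_simps)
      have "(\<Sum>l<D. \<Sum>l'<D. p l * p l' * (x $ l * x $ l')) =
        (\<Sum>l<D. \<Sum>l'<D. ?c x l l' + (if l = l' then p l * p l * (x $ l * x $ l) else 0))"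
        by (intro sum.cong) auto
      also have "\<dots> = (\<Sum>l<D. \<Sum>l'<D. ?c x l l') + (\<Sum>l<D. p l * p l * (x $ l * x $ l))"
        by (simp add: sum.distrib)
      also have "(\<Sum>l<D. p l * p l * (x $ l * x $ l)) \<le> (\<Sum>l<D. 1 / 16 * (p l * x $ l))"
      proof (rule sum_mono)
        fix l assume "l \<in> {..<D}"
        then have l: "l < D" by simp
        have "p l * p l * (x $ l * x $ l) = p l * (p l * x $ l)"
          using x_sq[OF x l] by (simp add: power2_eq_square)
        also have "\<dots> \<le> 1 / 16 * (p l * x $ l)"
          using pe[OF l] p0 x_nonneg[OF x l] by (intro mult_right_mono) auto
        finally show "p l * p l * (x $ l * x $ l) \<le> 1 / 16 * (p l * x $ l)" .
      qed
      also have "\<dots> = H / 16" by (simp add: H_def sum_divide_distrib)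
      finally have "H * H - H / 16 \<le> (\<Sum>l<D. \<Sum>l'<D. ?c x l l')" using HH by simp
      moreover have "1 / 8 * H \<le> H * H" using H by (intro mult_right_mono) auto
      moreover have "a x i = h x i" using True by (simp add: a_def)
      ultimately show ?thesis using hH H by linarith
    qed
  qed
  also have "\<dots> = 32 * (\<Sum>l<D. \<Sum>l'<D. E (\<lambda>x. ?c x l l'))"
    by (simp add: E_sum)
  also have "\<dots> \<le> 32 * (\<Sum>l<D. \<Sum>l'<D. p l * p l' * (m / (real D)\<^sup>2))"
  proof (intro mult_left_mono sum_mono)
    fix l l' assume "l \<in> {..<D}" "l' \<in> {..<D}"
    then have l: "l < D" "l' < D" by auto
    show "E (\<lambda>x. ?c x l l') \<le> p l * p l' * (m / (real D)\<^sup>2)"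
    proof (cases "l = l'")
      case False
      then have "E (\<lambda>x. ?c x l l') = p l * p l' * E (\<lambda>x. x $ l * x $ l')" by simp
      then show ?thesis using p0 l False by (simp only:) (intro mult_left_mono E_xx_le mult_nonneg_nonneg, auto)
    qed (use p0 m_nonneg in auto)
  qed auto
  also have "\<dots> = 32 * (m / (real D)\<^sup>2) * (\<Sum>l<D. p l)\<^sup>2"
    by (simp add: power2_eq_square sum_product sum_distrib_left sum_divide_distrib algebra_simps)
  also have "\<dots> \<le> 32 * (m / (real D)\<^sup>2) * (8 * r * e\<^sup>2)\<^sup>2"
  proof (intro mult_left_mono power_mono)
    have "(\<Sum>l<D. p l) \<le> 8 * r * (\<Sum>l<D. (off_part G $$ (i, l))\<^sup>2)"
      using psq by (auto simp: sum_distrib_left intro: sum_mono)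
    also have "\<dots> \<le> 8 * r * e\<^sup>2" using off_row_sum[OF i] r by (intro mult_left_mono) auto
    finally show "(\<Sum>l<D. p l) \<le> 8 * r * e\<^sup>2" .
  qed (use m_nonneg p0 in \<open>auto intro: sum_nonneg\<close>)
  also have "\<dots> = 2048 * r\<^sup>2 * e ^ 4 / (real D)\<^sup>2 * m"
    by (simp add: power2_eq_square power_numeral_reduce)
  also have "\<dots> \<le> 2048 * r\<^sup>2 * e ^ 4 / (real D)\<^sup>2 * (1 / (2 * 10 ^ 20) * (k * real D * lam ^ 4 / r ^ 5))"
    using m_le by (intro mult_left_mono) auto
  also have "\<dots> = 2048 / (2 * 10 ^ 20) * (e * (k * lam / (r * D))) * (e ^ 3 * (lam ^ 3 / r ^ 2))"
    using D_pos r by (simp add: field_simps power_numeral_reduce)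
  also have "\<dots> \<le> 2048 / (2 * 10 ^ 20) * (e * (k * lam / (r * D))) * (1 * 8)"
  proof (intro mult_left_mono mult_mono)
    show "e ^ 3 \<le> 1" using e_le e_nonneg by (intro power_le_one) auto
    have "lam ^ 3 / r ^ 2 \<le> 2 ^ 3 / 1 ^ 2"
      using lam_le_2 lam_pos r_ge_1 by (intro frac_le power_mono) auto
    then show "lam ^ 3 / r ^ 2 \<le> 8" by simp
  qed (use e_nonneg k_pos lam_pos r in auto)
  also have "\<dots> = 8 * 2048 / (2 * 10 ^ 20) * (e * (k * lam / (r * D)))" by simp
  also have "\<dots> \<le> 1 / 10 ^ 10 * (e * (k * lam / (r * D)))"
    using e_nonneg k_pos lam_pos r by (intro mult_right_mono) auto
  finally show ?thesis .
qed

lemma E_b: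
  assumes i: "i < D"
  shows "E (\<lambda>x. \<bar>b x i\<bar>) \<le> 1 / 10 ^ 9 * (e * (k * lam / (r * D)))"
proof -
  have "E (\<lambda>x. \<bar>b x i\<bar>) \<le> E (\<lambda>x. 2 * (x $ i * \<bar>h x i\<bar>) + a x i)"
    using b_abs_le i by (intro E_mono) auto
  also have "\<dots> = 2 * E (\<lambda>x. x $ i * \<bar>h x i\<bar>) + E (\<lambda>x. a x i)" by simp
  also have "\<dots> \<le> 2 * (2 / 10 ^ 10 * (e * (k * lam / (r * D)))) + 1 / 10 ^ 10 * (e * (k * lam / (r * D)))"
    using E_x_h[OF i] E_a[OF i] by (intro add_mono mult_left_mono) auto
  also have "\<dots> = 5 / 10 ^ 10 * (e * (k * lam / (r * D)))" by simp
  also have "\<dots> \<le> 1 / 10 ^ 9 * (e * (k * lam / (r * D)))"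
    using e_nonneg k_pos lam_pos r_ge_1 by (intro mult_right_mono) auto
  finally show ?thesis .
qed

text \<open>Splitting each error as \<open>sqrt |b| * (sgn b * sqrt |b|)\<close> separates
  \<open>\<Sum> |b_i|\<close>, bounded surely by \<open>b_abs_sum\<close>, from
  \<open>\<Sum> v_i^2 |b_i|\<close>, bounded in expectation by \<open>E_b\<close>. The factors
  \<open>r\<close> cancel.\<close>

lemma E_b_form:
  "E (\<lambda>x. (\<Sum>i<D. v i * b x i)\<^sup>2) \<le> 3 / 10 ^ 9 * e\<^sup>2 * (k * lam / D) * (\<Sum>i<D. (v i)\<^sup>2)"
proof -
  have "E (\<lambda>x. (\<Sum>i<D. v i * b x i)\<^sup>2) \<le> E (\<lambda>x. \<Sum>i<D. 3 * r * e * (v i)\<^sup>2 * \<bar>b x i\<bar>)"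
  proof (rule E_mono)
    fix x assume x: "x \<in> set_pmf \<mu>"
    have "(\<Sum>i<D. v i * b x i)\<^sup>2 = (\<Sum>i<D. sqrt \<bar>b x i\<bar> * (v i * (sgn (b x i) * sqrt \<bar>b x i\<bar>)))\<^sup>2"
    proof (intro arg_cong[where f = "\<lambda>a. a\<^sup>2"] sum.cong refl)
      fix i
      have "sqrt \<bar>b x i\<bar> * (v i * (sgn (b x i) * sqrt \<bar>b x i\<bar>)) = v i * (sgn (b x i) * (sqrt \<bar>b x i\<bar> * sqrt \<bar>b x i\<bar>))"
        by (simp only: ac_simps)
      also have "sgn (b x i) * (sqrt \<bar>b x i\<bar> * sqrt \<bar>b x i\<bar>) = b x i"
        by (auto simp: sgn_if)
      finally show "v i * b x i = sqrt \<bar>b x i\<bar> * (v i * (sgn (b x i) * sqrt \<bar>b x i\<bar>))" by (rule sym)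
    qed
    also have "\<dots> \<le> (\<Sum>i<D. (sqrt \<bar>b x i\<bar>)\<^sup>2) * (\<Sum>i<D. (v i * (sgn (b x i) * sqrt \<bar>b x i\<bar>))\<^sup>2)"
      by (rule Cauchy_Schwarz_ineq_sum)
    also have "\<dots> \<le> (\<Sum>i<D. \<bar>b x i\<bar>) * (\<Sum>i<D. (v i)\<^sup>2 * \<bar>b x i\<bar>)"
      by (intro mult_mono sum_mono sum_nonneg) (auto simp: power_mult_distrib sgn_if)
    also have "\<dots> \<le> 3 * r * e * (\<Sum>i<D. (v i)\<^sup>2 * \<bar>b x i\<bar>)"
      using b_abs_sum[OF x] by (intro mult_right_mono) (auto intro: sum_nonneg)
    finally show "(\<Sum>i<D. v i * b x i)\<^sup>2 \<le> (\<Sum>i<D. 3 * r * e * (v i)\<^sup>2 * \<bar>b x i\<bar>)"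
      by (simp add: sum_distrib_left mult.assoc)
  qed
  also have "\<dots> = (\<Sum>i<D. 3 * r * e * (v i)\<^sup>2 * E (\<lambda>x. \<bar>b x i\<bar>))" by (simp add: E_sum)
  also have "\<dots> \<le> (\<Sum>i<D. 3 * r * e * (v i)\<^sup>2 * (1 / 10 ^ 9 * (e * (k * lam / (r * D)))))"
    using E_b r_ge_1 e_nonneg by (intro sum_mono mult_left_mono) auto
  also have "\<dots> = 3 / 10 ^ 9 * e\<^sup>2 * (k * lam / D) * (\<Sum>i<D. (v i)\<^sup>2)"
    using r_ge_1 by (simp add: sum_distrib_left sum_divide_distrib power2_eq_square field_simps)
  finally show ?thesis .
qed

text \<open>Uses \<open>(P + Q)^2 \<ge> P^2 / 2 - Q^2\<close>, which is
  \<open>(P + 2 Q)^2 \<ge> 0\<close>. The diagonal part has at least a quarter of the eigenvalue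
  bound of \<open>x\<close>, and the error costs at most a sixteenth:
  \<open>1/8 - 1/16 = 1/16\<close>. This is the strong convexity of the regression.\<close>

lemma E_z_form_ge: "k * lam / (16 * D) * (\<Sum>i<D. (u i)\<^sup>2) \<le> E (\<lambda>x. (\<Sum>i<D. u i * z x $ i)\<^sup>2)"
proof -
  let ?P = "\<lambda>x. \<Sum>i<D. (u i * G $$ (i, i)) * x $ i" and ?Q = "\<lambda>x. \<Sum>i<D. u i * b x i"
  have "k * lam / D * (1 / 4 * (\<Sum>i<D. (u i)\<^sup>2)) \<le> k * lam / D * (\<Sum>i<D. (u i * G $$ (i, i))\<^sup>2)"
    unfolding sum_distrib_left[of "1/4"]
  proof (intro mult_left_mono sum_mono)
    fix i assume "i \<in> {..<D}"
    then have "(1 / 2)\<^sup>2 \<le> (G $$ (i, i))\<^sup>2" using G_diag[of i] by (intro power_mono) auto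
    then have "1 / 4 * (u i)\<^sup>2 \<le> (G $$ (i, i))\<^sup>2 * (u i)\<^sup>2"
      by (intro mult_right_mono) (auto simp: power2_eq_square)
    then show "1 / 4 * (u i)\<^sup>2 \<le> (u i * G $$ (i, i))\<^sup>2" by (simp add: power_mult_distrib mult.commute)
  qed (use k_pos lam_pos in auto)
  also have "\<dots> \<le> E (\<lambda>x. (?P x)\<^sup>2)" by (rule E_lin_ge)
  finally have 1: "k * lam / D * (1 / 4 * (\<Sum>i<D. (u i)\<^sup>2)) \<le> E (\<lambda>x. (?P x)\<^sup>2)" .
  have "3 / 10 ^ 9 * e\<^sup>2 * (k * lam / D) * (\<Sum>i<D. (u i)\<^sup>2) \<le> 1 / 16 * (k * lam / D) * (\<Sum>i<D. (u i)\<^sup>2)"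
  proof (intro mult_right_mono)
    have "e\<^sup>2 \<le> 1" using e_le e_nonneg by (intro power_le_one) auto
    then show "3 / 10 ^ 9 * e\<^sup>2 \<le> 1 / 16" by simp
  qed (use k_pos lam_pos in \<open>auto intro: sum_nonneg\<close>)
  then have 2: "E (\<lambda>x. (?Q x)\<^sup>2) \<le> 1 / 16 * (k * lam / D) * (\<Sum>i<D. (u i)\<^sup>2)"
    using E_b_form[of u] by linarith
  have "1 / 2 * E (\<lambda>x. (?P x)\<^sup>2) - E (\<lambda>x. (?Q x)\<^sup>2) = E (\<lambda>x. 1 / 2 * (?P x)\<^sup>2 - (?Q x)\<^sup>2)"
    by simp
  also have "\<dots> \<le> E (\<lambda>x. (\<Sum>i<D. u i * z x $ i)\<^sup>2)"
  proof (rule E_mono)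
    fix x
    have eq: "(\<Sum>i<D. u i * z x $ i) = ?P x + ?Q x"
      by (simp add: b_def algebra_simps flip: sum.distrib)
    have "0 \<le> (?P x + 2 * ?Q x)\<^sup>2" by simp
    then show "1 / 2 * (?P x)\<^sup>2 - (?Q x)\<^sup>2 \<le> (\<Sum>i<D. u i * z x $ i)\<^sup>2"
      unfolding eq by (simp add: power2_eq_square algebra_simps)
  qed
  finally show ?thesis using 1 2 by (simp add: field_simps)
qed

end

section \<open>The regression matrix of a stage\<close>

lemma off_part_carrier [simp]: "A \<in> carrier_mat m n \<Longrightarrow> off_part A \<in> carrier_mat m n"
  by (simp add: off_part_def)

lemma mat_diag_index: "i < n \<Longrightarrow> j < n \<Longrightarrow> mat_diag n f $$ (i, j) = (if i = j then f j else 0)"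
  by (simp add: mat_diag_def)

lemma diagonal_mat_diag: "diagonal_mat (mat_diag n f)"
  by (simp add: mat_diag_def diagonal_mat_def)

lemma diag_plus_off:
  "A \<in> carrier_mat n n \<Longrightarrow> mat_diag n (\<lambda>i. A $$ (i, i)) + off_part A = A"
  by (intro eq_matI) (auto simp: mat_diag_def off_part_def)

lemma vec_add_diff_cancel:
  "v \<in> carrier_vec n \<Longrightarrow> w \<in> carrier_vec n \<Longrightarrow> v + w - w = v" for v w :: "real vec"
  by (intro eq_vecI) auto

lemma op_le_mat_diag:
  "(\<And>i. i < n \<Longrightarrow> \<bar>f i\<bar> \<le> c) \<Longrightarrow> 0 \<le> c \<Longrightarrow> op_le (mat_diag n f) c"
  by (rule op_le_diagonal[OF mat_diag_dim diagonal_mat_diag]) (auto simp: mat_diag_index)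

lemma op_le_off_part:
  assumes "op_le A c" "A \<in> carrier_mat n n" "0 \<le> c"
  shows "op_le (off_part A) (2 * c)"
proof -
  have "op_le (A - mat_diag n (\<lambda>i. A $$ (i, i))) (c + c)"
    using assms by (intro op_le_diff[OF _ op_le_mat_diag]) (auto intro: op_le_entry)
  moreover have "A - mat_diag n (\<lambda>i. A $$ (i, i)) = off_part A"
    using assms by (intro eq_matI) (auto simp: mat_diag_def off_part_def)
  ultimately show ?thesis by simp
qed

context decoding
begin

text \<open>The equations are the normal equations, solved by \<open>C R^-1\<close>. For the
  distance \<open>P\<close> to the diagonal matrix, bounding \<open>P R\<close> and
  \<open>R^-1\<close> separately would lose the condition number of \<open>R\<close>. Instead, with
  \<open>y = P u\<close> and \<open>w = R^-1 u\<close>, \<open>|y|^2\<close> is an expectation of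
  \<open>b\<close> against \<open>\<langle>w, z\<rangle>\<close>, and \<open>E \<langle>w,
  z\<rangle>^2 = w \<bullet> (R w) \<le> |u|^2 / \<rho>\<close> matches the scale of
  \<open>E_b_form\<close>.\<close>

lemma regression_exists:
  "\<exists>M \<in> carrier_mat D D. (\<forall>i<D. \<forall>j<D. E (\<lambda>x. (x $ i - (\<Sum>l<D. M $$ (i, l) * z x $ l)) * z x $ j) = 0) \<and>
     op_le (M - mat_diag D (\<lambda>i. 1 / G $$ (i, i))) (e / 2000)"
proof -
  define \<rho> where "\<rho> = k * lam / (16 * D)"
  have \<rho>: "0 < \<rho>" using k_pos lam_pos D_pos by (simp add: \<rho>_def)
  define R where "R = mat D D (\<lambda>(i, j). E (\<lambda>x. z x $ i * z x $ j))"
  define C where "C = mat D D (\<lambda>(i, j). E (\<lambda>x. x $ i * z x $ j))"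
  define Sg where "Sg = mat_diag D (\<lambda>i. 1 / G $$ (i, i))"
  have R: "R \<in> carrier_mat D D" and C: "C \<in> carrier_mat D D" and Sg: "Sg \<in> carrier_mat D D"
    by (auto simp: R_def C_def Sg_def)
  have form: "v \<bullet> (R *\<^sub>v v) = E (\<lambda>x. (\<Sum>i<D. v $ i * z x $ i)\<^sup>2)" if v: "v \<in> carrier_vec D" for v
  proof -
    have "v \<bullet> (R *\<^sub>v v) = (\<Sum>i<D. v $ i * (\<Sum>j<D. E (\<lambda>x. z x $ i * z x $ j) * v $ j))"
      using mult_mat_vec_sum[OF R v]
      by (subst scalar_prod_sum[OF mult_mat_vec_carrier[OF R v]])
         (auto simp: R_def simp del: index_mult_mat_vec intro!: sum.cong)
    also have "\<dots> = E (\<lambda>x. (\<Sum>i<D. v $ i * z x $ i)\<^sup>2)"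
      by (simp add: power2_eq_square sum_product E_sum sum_distrib_left algebra_simps)
    finally show ?thesis .
  qed
  have lower: "\<rho> * (vnorm v)\<^sup>2 \<le> v \<bullet> (R *\<^sub>v v)" if v: "v \<in> carrier_vec D" for v
    unfolding form[OF v] vnorm_sq[OF v] \<rho>_def by (rule E_z_form_ge)
  have "\<exists>W \<in> carrier_mat D D. R * W = 1\<^sub>m D \<and> W * R = 1\<^sub>m D"
  proof (rule inverse_mat_exists[OF R])
    fix v assume v: "v \<in> carrier_vec D" and "R *\<^sub>v v = 0\<^sub>v D"
    then have "\<rho> * (vnorm v)\<^sup>2 \<le> 0" using lower[OF v] by simp
    then have "vnorm v = 0" using \<rho> by (simp add: mult_le_0_iff)
    then show "v = 0\<^sub>v D" using vnorm_eq_0[OF v] by simp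
  qed
  then obtain W where W: "W \<in> carrier_mat D D" and RW: "R * W = 1\<^sub>m D" and WR: "W * R = 1\<^sub>m D"
    by blast
  define M where "M = C * W"
  have M: "M \<in> carrier_mat D D" using C W by (simp add: M_def)
  have MR: "M * R = C" unfolding M_def using assoc_mult_mat[OF C W R] WR C by simp
  have orth: "E (\<lambda>x. (x $ i - (\<Sum>l<D. M $$ (i, l) * z x $ l)) * z x $ j) = 0" if "i < D" "j < D" for i j
  proof -
    have "E (\<lambda>x. (x $ i - (\<Sum>l<D. M $$ (i, l) * z x $ l)) * z x $ j)
      = E (\<lambda>x. x $ i * z x $ j) - (\<Sum>l<D. M $$ (i, l) * E (\<lambda>x. z x $ l * z x $ j))"
      by (simp add: left_diff_distrib sum_distrib_right mult.assoc E_sum)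
    also have "(\<Sum>l<D. M $$ (i, l) * E (\<lambda>x. z x $ l * z x $ j)) = (M * R) $$ (i, j)"
      using M R that by (auto simp: scalar_prod_sum[of _ D] R_def intro!: sum.cong)
    finally show ?thesis using that by (simp add: MR C_def)
  qed
  define P where "P = M - Sg"
  have P: "P \<in> carrier_mat D D" unfolding P_def by (rule minus_carrier_mat[OF Sg])
  define \<beta> where "\<beta> = 3 / 10 ^ 9 * e\<^sup>2 * (k * lam / D)"
  have \<beta>: "\<beta> = 48 / 10 ^ 9 * e\<^sup>2 * \<rho>" by (simp add: \<beta>_def \<rho>_def)
  have \<beta>0: "0 \<le> \<beta>" using \<rho> by (simp add: \<beta>)
  have "op_le P (e / 2000)"
  proof (rule op_leI[OF P])
    fix u :: "real vec" assume u: "u \<in> carrier_vec D"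
    define w where "w = W *\<^sub>v u"
    have w: "w \<in> carrier_vec D" using W u by (simp add: w_def)
    have Rw: "R *\<^sub>v w = u" unfolding w_def using assoc_mult_mat_vec[OF R W u] RW u by simp
    define y where "y = P *\<^sub>v u"
    have y: "y \<in> carrier_vec D" using P u by (simp add: y_def)
    have wu: "w \<bullet> (R *\<^sub>v w) \<le> vnorm w * vnorm u"
      using vnorm_cauchy[OF w u] Rw by simp
    have "\<rho> * vnorm w * vnorm w \<le> vnorm u * vnorm w"
      using lower[OF w] wu by (simp add: power2_eq_square mult_ac)
    then have "\<rho> * vnorm w \<le> vnorm u"
      using vnorm_nonneg[of w] by (cases "vnorm w = 0") (auto simp: mult_le_cancel_right less_le)
    then have "vnorm w * vnorm u \<le> vnorm u / \<rho> * vnorm u"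
      using \<rho> by (intro mult_right_mono) (auto simp: field_simps)
    then have upper: "E (\<lambda>x. (\<Sum>i<D. w $ i * z x $ i)\<^sup>2) \<le> (vnorm u)\<^sup>2 / \<rho>"
      using wu form[OF w] by (simp add: power2_eq_square)
    \<comment> \<open>Since \<open>x_i = (z_i - b_i) / G_ii\<close>, subtracting the diagonal
      candidate leaves exactly the contribution of \<open>b\<close>.\<close>
    have PR: "(P * R) $$ (i, j) = - E (\<lambda>x. b x i / G $$ (i, i) * z x $ j)" if "i < D" "j < D" for i j
    proof -
      have "(Sg * R) $$ (i, j) = 1 / G $$ (i, i) * E (\<lambda>x. z x $ i * z x $ j)"
        unfolding Sg_def using R that by (simp add: mat_diag_mult_left[OF R]) (simp add: R_def)
      moreover have "P * R = C - Sg * R"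
        unfolding P_def using minus_mult_distrib_mat[OF M Sg R] MR by simp
      ultimately have "(P * R) $$ (i, j) = E (\<lambda>x. x $ i * z x $ j) - 1 / G $$ (i, i) * E (\<lambda>x. z x $ i * z x $ j)"
        using that C R Sg by (simp add: C_def)
      also have "\<dots> = E (\<lambda>x. x $ i * z x $ j - 1 / G $$ (i, i) * (z x $ i * z x $ j))" by simp
      also have "\<dots> = E (\<lambda>x. - (b x i / G $$ (i, i) * z x $ j))"
        using G_diag[OF that(1)] by (intro E_cong) (auto simp: b_def field_simps)
      finally show ?thesis by simp
    qed
    have "y = (P * R) *\<^sub>v w" unfolding y_def using assoc_mult_mat_vec[OF P R w] Rw by simp
    then have yi: "y $ i = (\<Sum>j<D. (P * R) $$ (i, j) * w $ j)" if "i < D" for i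
      using mult_mat_vec_sum[of "P * R" D D w i] P R w that by simp
    have "(vnorm y)\<^sup>2 = (\<Sum>i<D. y $ i * y $ i)" unfolding vnorm_sq[OF y] by (simp add: power2_eq_square)
    also have "\<dots> = (\<Sum>i<D. y $ i * (\<Sum>j<D. - E (\<lambda>x. b x i / G $$ (i, i) * z x $ j) * w $ j))"
      by (intro sum.cong arg_cong2[where f = "(*)"] refl) (auto simp: yi PR simp del: index_mult_mat)
    also have "\<dots> = - E (\<lambda>x. (\<Sum>i<D. (y $ i / G $$ (i, i)) * b x i) * (\<Sum>j<D. w $ j * z x $ j))"
      by (simp add: sum_product E_sum sum_distrib_left sum_divide_distrib sum_negf algebra_simps)
    finally have "(vnorm y)\<^sup>2 \<le> \<bar>E (\<lambda>x. (\<Sum>i<D. (y $ i / G $$ (i, i)) * b x i) * (\<Sum>j<D. w $ j * z x $ j))\<bar>"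
      by linarith
    then have "((vnorm y)\<^sup>2)\<^sup>2 \<le> (E (\<lambda>x. (\<Sum>i<D. (y $ i / G $$ (i, i)) * b x i) * (\<Sum>j<D. w $ j * z x $ j)))\<^sup>2"
      using power_mono[of "(vnorm y)\<^sup>2" _ 2] by fastforce
    also have "\<dots> \<le> E (\<lambda>x. (\<Sum>i<D. (y $ i / G $$ (i, i)) * b x i)\<^sup>2) * E (\<lambda>x. (\<Sum>j<D. w $ j * z x $ j)\<^sup>2)"
      by (rule E_cauchy)
    also have "\<dots> \<le> (\<beta> * (4 * (vnorm y)\<^sup>2)) * ((vnorm u)\<^sup>2 / \<rho>)"
    proof (rule mult_mono[OF _ upper])
      have "E (\<lambda>x. (\<Sum>i<D. (y $ i / G $$ (i, i)) * b x i)\<^sup>2) \<le> \<beta> * (\<Sum>i<D. (y $ i / G $$ (i, i))\<^sup>2)"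
        unfolding \<beta>_def by (rule E_b_form)
      also have "\<dots> \<le> \<beta> * (\<Sum>i<D. 4 * (y $ i)\<^sup>2)"
      proof (intro mult_left_mono sum_mono \<beta>0)
        fix i assume "i \<in> {..<D}"
        then have g: "1 / 2 \<le> G $$ (i, i)" using G_diag by auto
        then have "\<bar>y $ i / G $$ (i, i)\<bar> \<le> \<bar>y $ i\<bar> / (1 / 2)"
          unfolding abs_divide by (intro frac_le) auto
        then have "\<bar>y $ i / G $$ (i, i)\<bar>\<^sup>2 \<le> (\<bar>y $ i\<bar> / (1 / 2))\<^sup>2"
          by (intro power_mono) auto
        then show "(y $ i / G $$ (i, i))\<^sup>2 \<le> 4 * (y $ i)\<^sup>2"
          unfolding power2_abs by (simp add: power_mult_distrib)
      qed
      also have "\<dots> = \<beta> * (4 * (vnorm y)\<^sup>2)" by (simp add: vnorm_sq[OF y] sum_distrib_left)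
      finally show "E (\<lambda>x. (\<Sum>i<D. (y $ i / G $$ (i, i)) * b x i)\<^sup>2) \<le> \<beta> * (4 * (vnorm y)\<^sup>2)" .
    qed (use \<beta>0 in \<open>auto intro: E_nonneg\<close>)
    also have "\<dots> = 192 / 10 ^ 9 * (e * vnorm u)\<^sup>2 * (vnorm y)\<^sup>2"
      using \<rho> by (simp add: \<beta> power_mult_distrib)
    finally have "(vnorm y)\<^sup>2 * (vnorm y)\<^sup>2 \<le> 192 / 10 ^ 9 * (e * vnorm u)\<^sup>2 * (vnorm y)\<^sup>2"
      by (simp add: power2_eq_square[of "(vnorm y)\<^sup>2"])
    then have "(vnorm y)\<^sup>2 \<le> 192 / 10 ^ 9 * (e * vnorm u)\<^sup>2"
      by (rule le_of_mult_self_le) auto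
    \<comment> \<open>\<open>1 / 2000^2\<close> is \<open>250 / 10^9\<close>, just above
      \<open>192 / 10^9\<close>.\<close>
    also have "\<dots> \<le> 1 / 2000\<^sup>2 * (e * vnorm u)\<^sup>2" by (intro mult_right_mono) auto
    also have "\<dots> = (e / 2000 * vnorm u)\<^sup>2" by (simp add: power_mult_distrib power_divide)
    finally show "vnorm (P *\<^sub>v u) \<le> e / 2000 * vnorm u"
      using e_nonneg by (auto simp: y_def intro: power2_le_imp_le)
  qed
  then show ?thesis using M orth by (auto simp: P_def Sg_def)
qed

end

section \<open>Inverting a nearly diagonal factor\<close>

context binary_gcc
begin

text \<open>Perturbation of the diagonal part: with its inverse \<open>V\<close>,
  \<open>V M = 1 + V N\<close> and \<open>|V N| \<le> 2 d\<close>. The resulting lower bound on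
  \<open>|M v|\<close> yields both invertibility and \<open>|G| \<le> 3\<close>. Multiplying by
  \<open>G\<close> gives \<open>V = G + F\<close> with \<open>|F| \<le> 6 d\<close>. Removing the
  diagonal doubles this to \<open>12 d\<close>; passing from \<open>G_ii\<close> back to its
  reciprocal costs \<open>(3/2) / (1/2)\<close>, whence \<open>18 d\<close>.\<close>

lemma decoding_inverse:
  assumes M: "M \<in> carrier_mat D D" and M_diag: "\<And>i. i < D \<Longrightarrow> \<bar>M $$ (i, i) - 1\<bar> \<le> 1 / 2"
    and off: "op_le (off_part M) d" and d: "0 \<le> d" "d \<le> 1 / 200"
    and m_le: "m \<le> 1 / (2 * 10 ^ 20) * (k * real D * lam ^ 4 / r ^ 5)"
  shows "\<exists>G \<in> carrier_mat D D. M * G = 1\<^sub>m D \<and> G * M = 1\<^sub>m D \<and> op_le G 3 \<and>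
    decoding D r k m lam \<mu> G (12 * d) \<and> (\<forall>i<D. \<bar>1 / G $$ (i, i) - M $$ (i, i)\<bar> \<le> 18 * d)"
proof -
  let ?s = "\<lambda>i. M $$ (i, i)"
  define S where "S = mat_diag D ?s"
  define N where "N = off_part M"
  define V where "V = mat_diag D (\<lambda>i. 1 / ?s i)"
  have s: "1 / 2 \<le> ?s i" "?s i \<le> 3 / 2" if "i < D" for i using M_diag[OF that] by linarith+
  have S: "S \<in> carrier_mat D D" and N: "N \<in> carrier_mat D D" and V: "V \<in> carrier_mat D D"
    using M by (auto simp: S_def N_def V_def)
  have MSN: "M = S + N" unfolding S_def N_def using diag_plus_off[OF M] by simp
  have VS: "V * S = 1\<^sub>m D"
  proof -
    have "V * S = mat_diag D (\<lambda>i. 1 / ?s i * ?s i)" by (simp add: V_def S_def)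
    also have "\<dots> = 1\<^sub>m D"
    proof (rule eq_matI)
      fix i j assume "i < dim_row (1\<^sub>m D)" "j < dim_col (1\<^sub>m D)"
      then show "mat_diag D (\<lambda>i. 1 / ?s i * ?s i) $$ (i, j) = 1\<^sub>m D $$ (i, j)"
        using s(1)[of j] by (auto simp: mat_diag_def)
    qed (auto simp: mat_diag_def)
    finally show ?thesis .
  qed
  have opV: "op_le V 2"
    unfolding V_def
  proof (rule op_le_mat_diag)
    fix i assume "i < D"
    from s(1)[OF this] show "\<bar>1 / ?s i\<bar> \<le> 2" by (simp add: field_simps)
  qed simp
  have opN: "op_le N d" using off by (simp add: N_def)
  have opVN: "op_le (V * N) (2 * d)" by (rule op_le_mult[OF opV opN V N]) simp
  have VN: "V * N \<in> carrier_mat D D" using V N by simp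
  have VM: "V * M = 1\<^sub>m D + V * N"
    unfolding MSN using mult_add_distrib_mat[OF V S N] VS by simp
  have lower: "(1 - 2 * d) * vnorm v \<le> 2 * vnorm (M *\<^sub>v v)" if v: "v \<in> carrier_vec D" for v
  proof -
    have VNv: "(V * N) *\<^sub>v v \<in> carrier_vec D" using VN v by simp
    have VMv: "V *\<^sub>v (M *\<^sub>v v) \<in> carrier_vec D" using V M v by simp
    have "V *\<^sub>v (M *\<^sub>v v) = v + (V * N) *\<^sub>v v"
      using assoc_mult_mat_vec[OF V M v] add_mult_distrib_mat_vec[OF one_carrier_mat VN v] v VM by simp
    moreover have "v + (V * N) *\<^sub>v v - (V * N) *\<^sub>v v = v"
      by (rule vec_add_diff_cancel[OF v VNv])
    ultimately have "v = V *\<^sub>v (M *\<^sub>v v) - (V * N) *\<^sub>v v" by simp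
    then have "vnorm v \<le> vnorm (V *\<^sub>v (M *\<^sub>v v)) + vnorm ((V * N) *\<^sub>v v)"
      using vnorm_diff[OF VMv VNv] by simp
    also have "\<dots> \<le> 2 * vnorm (M *\<^sub>v v) + 2 * d * vnorm v"
      using op_leD[OF opV V, of "M *\<^sub>v v"] op_leD[OF opVN VN v] M v by (intro add_mono) auto
    finally show ?thesis by (simp add: algebra_simps)
  qed
  have "\<exists>G \<in> carrier_mat D D. M * G = 1\<^sub>m D \<and> G * M = 1\<^sub>m D"
  proof (rule inverse_mat_exists[OF M])
    fix v assume v: "v \<in> carrier_vec D" and "M *\<^sub>v v = 0\<^sub>v D"
    then have "(1 - 2 * d) * vnorm v \<le> 0" using lower[OF v] by simp
    then have "vnorm v = 0" using d vnorm_nonneg[of v] by (auto simp: mult_le_0_iff)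
    then show "v = 0\<^sub>v D" using vnorm_eq_0[OF v] by simp
  qed
  then obtain G where G: "G \<in> carrier_mat D D" and MG: "M * G = 1\<^sub>m D" and GM: "G * M = 1\<^sub>m D" by blast
  have opG: "op_le G 3"
  proof (rule op_leI[OF G])
    fix u :: "real vec" assume u: "u \<in> carrier_vec D"
    have "M *\<^sub>v (G *\<^sub>v u) = u" using assoc_mult_mat_vec[OF M G u] MG u by simp
    then have "(1 - 2 * d) * vnorm (G *\<^sub>v u) \<le> 2 * vnorm u" using lower[of "G *\<^sub>v u"] G u by simp
    moreover have "2 / 3 * vnorm (G *\<^sub>v u) \<le> (1 - 2 * d) * vnorm (G *\<^sub>v u)"
      using d by (intro mult_right_mono) auto
    ultimately show "vnorm (G *\<^sub>v u) \<le> 3 * vnorm u" by linarith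
  qed
  define F where "F = V * N * G"
  have F: "F \<in> carrier_mat D D" using VN G by (simp add: F_def)
  have opF: "op_le F (6 * d)"
    using op_le_mult[OF opVN opG VN G] d by (simp add: F_def)
  have "V = V * M * G" using assoc_mult_mat[OF V M G] MG V by simp
  also have "\<dots> = G + F"
    unfolding VM F_def using add_mult_distrib_mat[OF one_carrier_mat VN G] G by simp
  finally have VGF: "V = G + F" .
  have Gij: "G $$ (i, j) = V $$ (i, j) - F $$ (i, j)" if "i < D" "j < D" for i j
    using that F G by (simp add: VGF)
  have Fii: "\<bar>F $$ (i, i)\<bar> \<le> 6 * d" if "i < D" for i
    using op_le_entry[OF opF F that that] d by simp
  have "off_part G = - off_part F"
    using G F Gij by (intro eq_matI) (auto simp: off_part_def V_def mat_diag_def)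
  then have opO: "op_le (off_part G) (12 * d)"
    using op_le_uminus[OF op_le_off_part[OF opF F]] d by simp
  have Gii: "\<bar>G $$ (i, i) - 1 / ?s i\<bar> \<le> 6 * d" if "i < D" for i
    using Fii[OF that] Gij[OF that that] that by (simp add: V_def mat_diag_def)
  have g: "1 / 2 \<le> G $$ (i, i) \<and> G $$ (i, i) \<le> 3" if "i < D" for i
  proof -
    have "2 / 3 \<le> 1 / ?s i" "1 / ?s i \<le> 2" using s[OF that] by (auto simp: field_simps)
    then show ?thesis using Gii[OF that] d by (simp add: abs_le_iff)
  qed
  have "decoding D r k m lam \<mu> G (12 * d)"
    by unfold_locales (use G g opO d m_le in auto)
  moreover have "\<bar>1 / G $$ (i, i) - ?s i\<bar> \<le> 18 * d" if i: "i < D" for i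
  proof -
    have "\<bar>1 / G $$ (i, i) - ?s i\<bar> = ?s i / G $$ (i, i) * \<bar>G $$ (i, i) - 1 / ?s i\<bar>"
    proof -
      have "1 / G $$ (i, i) - ?s i = - (?s i / G $$ (i, i) * (G $$ (i, i) - 1 / ?s i))"
        using s[OF i] g[OF i] by (simp add: field_simps)
      then show ?thesis using s[OF i] g[OF i] by (simp add: abs_mult)
    qed
    also have "\<dots> \<le> (3 / 2) / (1 / 2) * (6 * d)"
      using s[OF i] g[OF i] Gii[OF i] d by (intro mult_mono frac_le) auto
    finally show ?thesis by simp
  qed
  ultimately show ?thesis using G MG GM opG by blast
qed

end

section \<open>Stochastic gradient descent within a stage\<close>

text \<open>The square of the Frobenius norm. As a plain sum over the entries it can be averaged row
  by row, and its expectation is the quantity to which Markov's inequality is applied.\<close>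

definition frob :: "real mat \<Rightarrow> real" where
  "frob A = (\<Sum>i<dim_row A. \<Sum>j<dim_col A. (A $$ (i, j))\<^sup>2)"

lemma frob_nonneg: "0 \<le> frob A"
  by (auto simp: frob_def intro!: sum_nonneg)

lemma op_le_frob: "A \<in> carrier_mat m n \<Longrightarrow> frob A \<le> c\<^sup>2 \<Longrightarrow> 0 \<le> c \<Longrightarrow> op_le A c"
  by (rule op_le_frobenius) (auto simp: frob_def)

primrec sgd ::
  "real vec pmf \<Rightarrow> (real vec \<Rightarrow> real vec) \<Rightarrow> real \<Rightarrow> real mat \<Rightarrow> nat \<Rightarrow> real mat pmf" where
  "sgd \<mu> f \<eta> M 0 = return_pmf M"
| "sgd \<mu> f \<eta> M (Suc t) =
    bind_pmf (sgd \<mu> f \<eta> M t) (\<lambda>N. map_pmf (\<lambda>x. N + \<eta> \<cdot>\<^sub>m outer (x - N *\<^sub>v f x) (f x)) \<mu>)"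

lemma outer_carrier: "u \<in> carrier_vec m \<Longrightarrow> v \<in> carrier_vec n \<Longrightarrow> outer u v \<in> carrier_mat m n"
  by (auto simp: outer_def)

lemma outer_index:
  "u \<in> carrier_vec m \<Longrightarrow> v \<in> carrier_vec n \<Longrightarrow> i < m \<Longrightarrow> j < n \<Longrightarrow> outer u v $$ (i, j) = u $ i * v $ j"
  by (simp add: outer_def)

lemma finite_sgd: "finite (set_pmf \<mu>) \<Longrightarrow> finite (set_pmf (sgd \<mu> f \<eta> M t))"
  by (induction t) auto

lemma sgd_carrier:
  assumes "\<And>x. x \<in> set_pmf \<mu> \<Longrightarrow> x \<in> carrier_vec m" "\<And>x. x \<in> set_pmf \<mu> \<Longrightarrow> f x \<in> carrier_vec n" "M \<in> carrier_mat m n"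
    "N \<in> set_pmf (sgd \<mu> f \<eta> M t)"
  shows "N \<in> carrier_mat m n"
  using assms(4)
proof (induction t arbitrary: N)
  case 0
  then show ?case using assms by simp
next
  case (Suc t)
  then obtain N' x where N': "N' \<in> set_pmf (sgd \<mu> f \<eta> M t)" and x: "x \<in> set_pmf \<mu>"
    and N: "N = N' + \<eta> \<cdot>\<^sub>m outer (x - N' *\<^sub>v f x) (f x)" by auto
  have "N' \<in> carrier_mat m n" using Suc.IH[OF N'] .
  then have "x - N' *\<^sub>v f x \<in> carrier_vec m"
    using assms(1,2)[OF x] by (intro minus_carrier_vec mult_mat_vec_carrier)
  then show ?case
    unfolding N using assms(2)[OF x] by (intro add_carrier_mat smult_carrier_mat outer_carrier)
qed

text \<open>\<open>(1 - y)^n (1 + y)^n \<le> 1\<close> together with Bernoulli's inequality for the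
  second factor. This decay is slower than exponential but still gives a polynomial number of
  steps.\<close>

lemma power_one_minus_le:
  fixes y :: real
  assumes "0 < y" "y \<le> 1" "0 < n"
  shows "(1 - y) ^ n \<le> 1 / (n * y)"
proof -
  have "1 + real n * y \<le> (1 + y) ^ n" using assms by (intro Bernoulli_inequality) auto
  then have "(1 - y) ^ n * (real n * y) \<le> (1 - y) ^ n * (1 + y) ^ n"
    using assms by (intro mult_left_mono) auto
  also have "\<dots> = (1 - y * y) ^ n" by (simp add: algebra_simps flip: power_mult_distrib)
  also have "\<dots> \<le> 1" using assms by (intro power_le_one) (auto simp: mult_le_one)
  finally show ?thesis using assms by (simp add: field_simps)
qed

context decoding
begin

text \<open>With residual \<open>w\<close> at the minimiser and \<open>q = N z\<close> for the
  current deviation \<open>N\<close>, a row of the deviation becomes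
  \<open>N_i + \<eta> (w_i - q_i) z\<close>. The normal equations kill the cross term
  \<open>w q\<close>; \<open>E_z_form_ge\<close> turns the drift \<open>q^2\<close> into
  contraction, and only the variance of \<open>w\<close> remains as noise.\<close>

lemma sgd_step:
  assumes Mst: "Mst \<in> carrier_mat D D"
    and orth: "\<And>i j. i < D \<Longrightarrow> j < D \<Longrightarrow> E (\<lambda>x. (x $ i - (\<Sum>l<D. Mst $$ (i, l) * z x $ l)) * z x $ j) = 0"
    and B: "\<And>x. x \<in> set_pmf \<mu> \<Longrightarrow> (\<Sum>i<D. (z x $ i)\<^sup>2) \<le> B" and \<eta>: "0 \<le> \<eta>" "\<eta> * B \<le> 1 / 2"
    and M: "M \<in> carrier_mat D D"
  shows "E (\<lambda>x. frob (M + \<eta> \<cdot>\<^sub>m outer (x - M *\<^sub>v z x) (z x) - Mst))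
    \<le> (1 - \<eta> * (k * lam / (16 * D))) * frob (M - Mst) + 2 * \<eta>\<^sup>2 * B * D"
proof -
  define N where "N i j = M $$ (i, j) - Mst $$ (i, j)" for i j
  define w where "w x i = x $ i - (\<Sum>l<D. Mst $$ (i, l) * z x $ l)" for x :: "real vec" and i
  define q where "q x i = (\<Sum>l<D. N i l * z x $ l)" for x i
  define \<rho> where "\<rho> = k * lam / (16 * D)"
  obtain x0 where "x0 \<in> set_pmf \<mu>" using set_pmf_not_empty by fast
  have "0 \<le> (\<Sum>i<D. (z x0 $ i)\<^sup>2)" by (auto intro: sum_nonneg)
  also have "\<dots> \<le> B" by (rule B) fact
  finally have B0: "0 \<le> B" .
  have frobM: "frob (M - Mst) = (\<Sum>i<D. \<Sum>j<D. (N i j)\<^sup>2)"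
    using M Mst by (auto simp: frob_def N_def intro!: sum.cong)
  have entry: "(M + \<eta> \<cdot>\<^sub>m outer (x - M *\<^sub>v z x) (z x) - Mst) $$ (i, j) = N i j + \<eta> * (w x i - q x i) * z x $ j"
    if "x \<in> set_pmf \<mu>" "i < D" "j < D" for x i j
  proof -
    have zx: "z x \<in> carrier_vec D" by (rule z_dim)
    have "(M *\<^sub>v z x) $ i = (\<Sum>l<D. M $$ (i, l) * z x $ l)"
      by (rule mult_mat_vec_sum[OF M zx that(2)])
    then have "(x - M *\<^sub>v z x) $ i = w x i - q x i"
      using M that x_dim[OF that(1)]
      by (simp add: w_def q_def N_def left_diff_distrib sum_subtractf del: index_mult_mat_vec)
    moreover have u: "x - M *\<^sub>v z x \<in> carrier_vec D"
      using x_dim[OF that(1)] zx M by (intro minus_carrier_vec mult_mat_vec_carrier)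
    ultimately show ?thesis
      using M Mst that outer_carrier[OF u zx] outer_index[OF u zx that(2,3)] by (simp add: N_def)
  qed
  have row: "E (\<lambda>x. \<Sum>j<D. (N i j + \<eta> * (w x i - q x i) * z x $ j)\<^sup>2)
      \<le> (1 - \<eta> * \<rho>) * (\<Sum>j<D. (N i j)\<^sup>2) + 2 * \<eta>\<^sup>2 * B" if i: "i < D" for i
  proof -
    have wz: "E (\<lambda>x. w x i * (\<Sum>l<D. c l * z x $ l)) = 0" for c :: "nat \<Rightarrow> real"
    proof -
      have "E (\<lambda>x. w x i * (\<Sum>l<D. c l * z x $ l)) = E (\<lambda>x. \<Sum>l<D. c l * (w x i * z x $ l))"
        by (simp add: sum_distrib_left algebra_simps)
      also have "\<dots> = (\<Sum>l<D. c l * E (\<lambda>x. w x i * z x $ l))" by (simp add: E_sum)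
      also have "\<dots> = 0" using orth[OF i] by (intro sum.neutral) (auto simp: w_def)
      finally show ?thesis .
    qed
    \<comment> \<open>Pythagoras: by \<open>wz\<close> the residual is orthogonal to the fitted
      value, so its second moment is at most that of \<open>x $ i\<close>.\<close>
    have ww: "E (\<lambda>x. (w x i)\<^sup>2) \<le> 1"
    proof -
      let ?p = "\<lambda>x. \<Sum>l<D. Mst $$ (i, l) * z x $ l"
      have "E (\<lambda>x. (w x i)\<^sup>2) + 2 * E (\<lambda>x. w x i * ?p x) + E (\<lambda>x. (?p x)\<^sup>2)
        = E (\<lambda>x. (w x i)\<^sup>2 + 2 * (w x i * ?p x) + (?p x)\<^sup>2)" by simp
      also have "\<dots> = E (\<lambda>x. (x $ i)\<^sup>2)"
        by (intro E_cong) (simp add: w_def power2_eq_square algebra_simps)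
      also have "\<dots> \<le> E (\<lambda>x. 1)"
        using x_cases[OF _ i] by (intro E_mono) fastforce
      finally have "E (\<lambda>x. (w x i)\<^sup>2) + 2 * E (\<lambda>x. w x i * ?p x) + E (\<lambda>x. (?p x)\<^sup>2) \<le> 1" by simp
      moreover have "0 \<le> E (\<lambda>x. (?p x)\<^sup>2)" by (intro E_nonneg) simp
      ultimately show ?thesis using wz[of "\<lambda>l. Mst $$ (i, l)"] by linarith
    qed
    have "E (\<lambda>x. \<Sum>j<D. (N i j + \<eta> * (w x i - q x i) * z x $ j)\<^sup>2)
      \<le> E (\<lambda>x. (\<Sum>j<D. (N i j)\<^sup>2) + 2 * \<eta> * (w x i * q x i) - \<eta> * (q x i)\<^sup>2 + 2 * \<eta>\<^sup>2 * B * (w x i)\<^sup>2)"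
    proof (rule E_mono)
      fix x assume x: "x \<in> set_pmf \<mu>"
      have "(\<Sum>j<D. (N i j + \<eta> * (w x i - q x i) * z x $ j)\<^sup>2)
        = (\<Sum>j<D. (N i j)\<^sup>2 + 2 * \<eta> * (w x i - q x i) * (N i j * z x $ j) + \<eta>\<^sup>2 * (w x i - q x i)\<^sup>2 * (z x $ j)\<^sup>2)"
        by (intro sum.cong) (auto simp: power2_eq_square algebra_simps)
      also have "\<dots> = (\<Sum>j<D. (N i j)\<^sup>2) + 2 * \<eta> * (w x i - q x i) * q x i + \<eta>\<^sup>2 * (w x i - q x i)\<^sup>2 * (\<Sum>j<D. (z x $ j)\<^sup>2)"
        by (simp add: sum.distrib sum_distrib_left q_def)
      also have "\<eta>\<^sup>2 * (w x i - q x i)\<^sup>2 * (\<Sum>j<D. (z x $ j)\<^sup>2) \<le> \<eta>\<^sup>2 * (2 * (w x i)\<^sup>2 + 2 * (q x i)\<^sup>2) * B"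
      proof (intro mult_mono B[OF x] order_refl)
        have "0 \<le> (w x i + q x i)\<^sup>2" by simp
        then show "(w x i - q x i)\<^sup>2 \<le> 2 * (w x i)\<^sup>2 + 2 * (q x i)\<^sup>2"
          by (simp add: power2_eq_square algebra_simps)
      qed (auto intro: sum_nonneg)
      also have "\<dots> = 2 * \<eta>\<^sup>2 * B * (w x i)\<^sup>2 + 2 * (\<eta> * B) * (\<eta> * (q x i)\<^sup>2)"
        by (simp add: power2_eq_square algebra_simps)
      \<comment> \<open>The condition \<open>\<eta> B \<le> 1/2\<close> lets the second-order term
        use up half of the drift \<open>2 \<eta> q^2\<close>; the other half is the
        contraction.\<close>
      also have "2 * (\<eta> * B) * (\<eta> * (q x i)\<^sup>2) \<le> 1 * (\<eta> * (q x i)\<^sup>2)"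
        using \<eta> by (intro mult_right_mono) auto
      finally show "(\<Sum>j<D. (N i j + \<eta> * (w x i - q x i) * z x $ j)\<^sup>2)
        \<le> (\<Sum>j<D. (N i j)\<^sup>2) + 2 * \<eta> * (w x i * q x i) - \<eta> * (q x i)\<^sup>2 + 2 * \<eta>\<^sup>2 * B * (w x i)\<^sup>2"
        by (simp add: power2_eq_square algebra_simps)
    qed
    also have "\<dots> = (\<Sum>j<D. (N i j)\<^sup>2) + 2 * \<eta> * E (\<lambda>x. w x i * q x i) - \<eta> * E (\<lambda>x. (q x i)\<^sup>2) + 2 * \<eta>\<^sup>2 * B * E (\<lambda>x. (w x i)\<^sup>2)"
      by simp
    also have "E (\<lambda>x. w x i * q x i) = 0" unfolding q_def by (rule wz)
    also have "(\<Sum>j<D. (N i j)\<^sup>2) + 2 * \<eta> * 0 - \<eta> * E (\<lambda>x. (q x i)\<^sup>2) + 2 * \<eta>\<^sup>2 * B * E (\<lambda>x. (w x i)\<^sup>2)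
      \<le> (\<Sum>j<D. (N i j)\<^sup>2) + 2 * \<eta> * 0 - \<eta> * (\<rho> * (\<Sum>j<D. (N i j)\<^sup>2)) + 2 * \<eta>\<^sup>2 * B * 1"
    proof (intro add_mono diff_mono mult_left_mono ww order_refl)
      show "\<rho> * (\<Sum>j<D. (N i j)\<^sup>2) \<le> E (\<lambda>x. (q x i)\<^sup>2)"
        unfolding q_def \<rho>_def by (rule E_z_form_ge)
    qed (use \<eta> B0 in auto)
    finally show ?thesis by (simp add: algebra_simps)
  qed
  have "E (\<lambda>x. frob (M + \<eta> \<cdot>\<^sub>m outer (x - M *\<^sub>v z x) (z x) - Mst))
    = E (\<lambda>x. \<Sum>i<D. \<Sum>j<D. (N i j + \<eta> * (w x i - q x i) * z x $ j)\<^sup>2)"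
  proof (rule E_cong)
    fix x assume x: "x \<in> set_pmf \<mu>"
    have "frob (M + \<eta> \<cdot>\<^sub>m outer (x - M *\<^sub>v z x) (z x) - Mst)
      = (\<Sum>i<D. \<Sum>j<D. ((M + \<eta> \<cdot>\<^sub>m outer (x - M *\<^sub>v z x) (z x) - Mst) $$ (i, j))\<^sup>2)"
      using Mst by (simp add: frob_def)
    also have "\<dots> = (\<Sum>i<D. \<Sum>j<D. (N i j + \<eta> * (w x i - q x i) * z x $ j)\<^sup>2)"
      using entry[OF x] by simp
    finally show "frob (M + \<eta> \<cdot>\<^sub>m outer (x - M *\<^sub>v z x) (z x) - Mst)
      = (\<Sum>i<D. \<Sum>j<D. (N i j + \<eta> * (w x i - q x i) * z x $ j)\<^sup>2)" .
  qed
  also have "\<dots> = (\<Sum>i<D. E (\<lambda>x. \<Sum>j<D. (N i j + \<eta> * (w x i - q x i) * z x $ j)\<^sup>2))"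
    by (rule E_sum)
  also have "\<dots> \<le> (\<Sum>i<D. (1 - \<eta> * \<rho>) * (\<Sum>j<D. (N i j)\<^sup>2) + 2 * \<eta>\<^sup>2 * B)"
    using row by (intro sum_mono) auto
  also have "\<dots> = (1 - \<eta> * \<rho>) * frob (M - Mst) + 2 * \<eta>\<^sup>2 * B * D"
    by (simp add: frobM sum.distrib sum_distrib_left)
  finally show ?thesis by (simp add: \<rho>_def)
qed

text \<open>The additive term is the fixed point of the affine recursion of \<open>sgd_step\<close>,
  so it does not grow with \<open>t\<close>.\<close>

lemma sgd_expectation:
  assumes Mst: "Mst \<in> carrier_mat D D"
    and orth: "\<And>i j. i < D \<Longrightarrow> j < D \<Longrightarrow> E (\<lambda>x. (x $ i - (\<Sum>l<D. Mst $$ (i, l) * z x $ l)) * z x $ j) = 0"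
    and B: "\<And>x. x \<in> set_pmf \<mu> \<Longrightarrow> (\<Sum>i<D. (z x $ i)\<^sup>2) \<le> B" and \<eta>: "0 < \<eta>" "\<eta> * B \<le> 1 / 2"
    and \<rho>: "\<rho> = k * lam / (16 * D)" "\<eta> * \<rho> \<le> 1"
    and M: "M \<in> carrier_mat D D"
  shows "measure_pmf.expectation (sgd \<mu> z \<eta> M t) (\<lambda>N. frob (N - Mst))
    \<le> (1 - \<eta> * \<rho>) ^ t * frob (M - Mst) + 2 * \<eta> * B * D / \<rho>"
proof (induction t)
  have \<rho>0: "0 < \<rho>" using \<rho> k_pos lam_pos D_pos by simp
  obtain x0 where "x0 \<in> set_pmf \<mu>" using set_pmf_not_empty by fast
  have "0 \<le> (\<Sum>i<D. (z x0 $ i)\<^sup>2)" by (auto intro: sum_nonneg)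
  also have "\<dots> \<le> B" by (rule B) fact
  finally have B0: "0 \<le> B" .
  {
    case 0
    show ?case using \<rho>0 B0 \<eta> by simp
  next
    case (Suc t)
    let ?P = "sgd \<mu> z \<eta> M t" and ?c = "2 * \<eta> * B * D / \<rho>"
    have fin: "finite (set_pmf ?P)" by (rule finite_sgd[OF finite_support])
    interpret P: finite_pmf ?P by unfold_locales (rule fin)
    have "measure_pmf.expectation (sgd \<mu> z \<eta> M (Suc t)) (\<lambda>N. frob (N - Mst))
      = (\<Sum>N\<in>set_pmf ?P. pmf ?P N * E (\<lambda>x. frob (N + \<eta> \<cdot>\<^sub>m outer (x - N *\<^sub>v z x) (z x) - Mst)))"
      using fin finite_support
      by (simp add: pmf_expectation_bind[OF fin])
    also have "\<dots> \<le> (\<Sum>N\<in>set_pmf ?P. pmf ?P N * ((1 - \<eta> * \<rho>) * frob (N - Mst) + 2 * \<eta>\<^sup>2 * B * D))"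
    proof (intro sum_mono mult_left_mono)
      fix N assume "N \<in> set_pmf ?P"
      then have "N \<in> carrier_mat D D" using sgd_carrier[of \<mu> D z D M N] x_dim z_dim M by blast
      then show "E (\<lambda>x. frob (N + \<eta> \<cdot>\<^sub>m outer (x - N *\<^sub>v z x) (z x) - Mst))
        \<le> (1 - \<eta> * \<rho>) * frob (N - Mst) + 2 * \<eta>\<^sup>2 * B * D"
        unfolding \<rho> using \<eta> by (intro sgd_step Mst orth B) auto
    qed auto
    also have "\<dots> = P.E (\<lambda>N. (1 - \<eta> * \<rho>) * frob (N - Mst) + 2 * \<eta>\<^sup>2 * B * D)"
      by (simp only: P.E_eq_sum)
    also have "\<dots> = (1 - \<eta> * \<rho>) * P.E (\<lambda>N. frob (N - Mst)) + 2 * \<eta>\<^sup>2 * B * D" by simp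
    also have "\<dots> \<le> (1 - \<eta> * \<rho>) * ((1 - \<eta> * \<rho>) ^ t * frob (M - Mst) + ?c) + 2 * \<eta>\<^sup>2 * B * D"
      using \<rho> by (intro add_right_mono mult_left_mono Suc.IH) auto
    also have "\<dots> = (1 - \<eta> * \<rho>) ^ Suc t * frob (M - Mst) + ?c"
      using \<rho>0 by (simp add: field_simps power2_eq_square)
    finally show ?case .
  }
qed

text \<open>The target is an expected squared error of at most \<open>p \<delta>^2\<close>, from
  which Markov's inequality gives failure probability \<open>p\<close>. The value of
  \<open>\<eta>\<close> makes the stationary noise exactly half of the target, using
  \<open>B = 9 D\<close>; the bound on \<open>n\<close> brings the transient below the other
  half.\<close>

lemma sgd_prob:
  assumes Mst: "Mst \<in> carrier_mat D D"
    and orth: "\<And>i j. i < D \<Longrightarrow> j < D \<Longrightarrow> E (\<lambda>x. (x $ i - (\<Sum>l<D. Mst $$ (i, l) * z x $ l)) * z x $ j) = 0"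
    and B: "\<And>x. x \<in> set_pmf \<mu> \<Longrightarrow> (\<Sum>i<D. (z x $ i)\<^sup>2) \<le> 9 * D"
    and \<rho>: "\<rho> = k * lam / (16 * D)"
    and p: "0 < p" "p \<le> 1" and \<delta>: "0 < \<delta>" "\<delta> \<le> 1"
    and \<eta>: "\<eta> = \<rho> * p * \<delta>\<^sup>2 / (36 * (real D)\<^sup>2)"
    and n: "0 < n" "2 * D / (\<eta> * \<rho> * p * \<delta>\<^sup>2) \<le> real n"
    and M: "M \<in> carrier_mat D D" "frob (M - Mst) \<le> D"
  shows "measure_pmf.prob (sgd \<mu> z \<eta> M n) {N. N \<in> carrier_mat D D \<and> op_le (N - Mst) \<delta>} \<ge> 1 - p"
proof -
  have \<rho>0: "0 < \<rho>" using \<rho> k_pos lam_pos D_pos by simp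
  have \<rho>1: "\<rho> \<le> 1"
    using k_lam_le \<rho> by simp
  have D1: "1 \<le> real D" using D_pos by simp
  have \<eta>0: "0 < \<eta>" using \<rho>0 p \<delta> D_pos by (simp add: \<eta>)
  have "\<rho> * p * \<delta>\<^sup>2 \<le> 1 * 1 * 1"
    using \<rho>0 \<rho>1 p \<delta> by (intro mult_mono power_le_one) auto
  then have \<eta>le: "\<eta> \<le> 1 / (36 * (real D)\<^sup>2)"
    unfolding \<eta> by (intro divide_right_mono) auto
  have \<eta>B: "\<eta> * (9 * D) \<le> 1 / 2"
  proof -
    have "\<eta> * (9 * D) \<le> 1 / (36 * (real D)\<^sup>2) * (9 * D)"
      using \<eta>le by (intro mult_right_mono) auto
    also have "\<dots> = 1 / 4 / D" using D_pos by (simp add: power2_eq_square)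
    also have "\<dots> \<le> 1 / 2" using D1 by (simp add: field_simps)
    finally show ?thesis .
  qed
  have \<eta>\<rho>: "\<eta> * \<rho> \<le> 1"
  proof -
    have "1 \<le> (real D)\<^sup>2" by (rule one_le_power[OF D1])
    then have "1 / (36 * (real D)\<^sup>2) \<le> 1 / 1" by (intro frac_le) linarith+
    then show ?thesis using \<eta>le \<eta>0 \<rho>0 \<rho>1 by (intro mult_le_one) auto
  qed
  let ?P = "sgd \<mu> z \<eta> M n"
  have fin: "finite (set_pmf ?P)" by (rule finite_sgd[OF finite_support])
  interpret P: finite_pmf ?P by unfold_locales (rule fin)
  have pd: "0 < p * \<delta>\<^sup>2" using p \<delta> by simp
  have "P.E (\<lambda>N. frob (N - Mst)) \<le> (1 - \<eta> * \<rho>) ^ n * frob (M - Mst) + 2 * \<eta> * (9 * D) * D / \<rho>"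
    by (rule sgd_expectation[OF Mst orth B \<eta>0 \<eta>B \<rho> \<eta>\<rho> M(1)])
  also have "2 * \<eta> * (9 * D) * D / \<rho> = p * \<delta>\<^sup>2 / 2"
    using \<rho>0 D_pos by (simp add: \<eta> power2_eq_square field_simps)
  also have "(1 - \<eta> * \<rho>) ^ n * frob (M - Mst) \<le> 1 / (n * (\<eta> * \<rho>)) * D"
    using \<eta>0 \<rho>0 \<eta>\<rho> n M by (intro mult_mono power_one_minus_le) (auto simp: frob_nonneg)
  also have "\<dots> \<le> p * \<delta>\<^sup>2 / 2"
    using n \<eta>0 \<rho>0 pd by (simp add: field_simps)
  finally have le: "P.E (\<lambda>N. frob (N - Mst)) \<le> p * \<delta>\<^sup>2" by simp
  let ?G = "{N. N \<in> carrier_mat D D \<and> op_le (N - Mst) \<delta>}"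
  have "1 - measure_pmf.prob ?P ?G = measure_pmf.prob ?P (- ?G)"
    using measure_pmf.prob_compl[of ?G ?P] by (simp add: Compl_eq_Diff_UNIV)
  also have "\<dots> = P.E (indicator (- ?G))" by simp
  also have "\<dots> \<le> P.E (\<lambda>N. frob (N - Mst) / \<delta>\<^sup>2)"
  proof (rule P.E_mono)
    fix N assume "N \<in> set_pmf ?P"
    then have N: "N \<in> carrier_mat D D" using sgd_carrier[of \<mu> D z D M N] x_dim z_dim M by blast
    show "indicator (- ?G) N \<le> frob (N - Mst) / \<delta>\<^sup>2"
    proof (cases "frob (N - Mst) \<le> \<delta>\<^sup>2")
      case True
      then have "N \<in> ?G"
        using N op_le_frob[OF minus_carrier_mat[OF Mst], of N] \<delta> by simp
      then show ?thesis by (simp add: frob_nonneg)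
    next
      case False
      then show ?thesis using \<delta> by (auto simp: indicator_def field_simps frob_nonneg)
    qed
  qed
  also have "\<dots> = P.E (\<lambda>N. frob (N - Mst)) / \<delta>\<^sup>2" by simp
  also have "\<dots> \<le> p" using le \<delta> by (simp add: field_simps)
  finally show ?thesis by simp
qed

end

section \<open>Composition of the stages\<close>

lemma mult_outer:
  assumes A: "A \<in> carrier_mat m n" and u: "u \<in> carrier_vec n" and v: "v \<in> carrier_vec p"
  shows "A * outer u v = outer (A *\<^sub>v u) v"
proof (rule eq_matI)
  fix i j assume "i < dim_row (outer (A *\<^sub>v u) v)" "j < dim_col (outer (A *\<^sub>v u) v)"
  then have ij: "i < m" "j < p" using A v by (auto simp: outer_def)
  have "col (outer u v) j = v $ j \<cdot>\<^sub>v u"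
    using ij u v by (intro eq_vecI) (auto simp: outer_def)
  then show "(A * outer u v) $$ (i, j) = outer (A *\<^sub>v u) v $$ (i, j)"
    using A u v ij by (simp add: outer_def)
qed (use A v in \<open>auto simp: outer_def\<close>)

text \<open>Counts only starts in \<open>A\<close>, so nothing is asked of \<open>f\<close>
  elsewhere; then \<open>(1 - a)(1 - b) \<ge> 1 - a - b\<close>. For \<open>b > 1\<close> the
  claimed bound is negative, and the case is split off because the integral works with nonnegative
  numbers.\<close>

lemma prob_bind_ge:
  assumes A: "1 - a \<le> measure_pmf.prob p A" and f: "\<And>x. x \<in> A \<Longrightarrow> 1 - b \<le> measure_pmf.prob (f x) S"
    and "0 \<le> a" "0 \<le> b"
  shows "1 - a - b \<le> measure_pmf.prob (bind_pmf p f) S"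
proof (cases "b \<le> 1")
  case True
  have "ennreal ((1 - b) * measure_pmf.prob p A) = (\<integral>\<^sup>+x. ennreal (1 - b) * indicator A x \<partial>measure_pmf p)"
    using True by (simp add: nn_integral_cmult_indicator measure_pmf.emeasure_eq_measure ennreal_mult)
  also have "\<dots> \<le> (\<integral>\<^sup>+x. emeasure (measure_pmf (f x)) S \<partial>measure_pmf p)"
    using f by (intro nn_integral_mono) (auto simp: indicator_def measure_pmf.emeasure_eq_measure intro!: ennreal_leI)
  also have "\<dots> = ennreal (measure_pmf.prob (bind_pmf p f) S)"
    by (simp flip: measure_pmf.emeasure_eq_measure)
  finally have "(1 - b) * measure_pmf.prob p A \<le> measure_pmf.prob (bind_pmf p f) S"
    by simp
  moreover have "(1 - b) * (1 - a) \<le> (1 - b) * measure_pmf.prob p A"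
    using A True by (intro mult_left_mono) auto
  moreover have "1 - a - b \<le> (1 - b) * (1 - a)" using assms by (simp add: algebra_simps)
  ultimately show ?thesis by linarith
next
  case False
  then show ?thesis using assms measure_nonneg[of "measure_pmf (bind_pmf p f)" S] by linarith
qed

context decoding
begin

text \<open>The pseudo-inverse \<open>Q\<close> of \<open>Astar M\<close> satisfies
  \<open>(Q Astar) M = 1\<close>; multiplying by \<open>G\<close> on the right gives
  \<open>Q Astar = G\<close>. So decoding \<open>Astar x\<close> is applying \<open>G\<close> to
  \<open>x\<close>, and by linearity every update stays a left multiple of
  \<open>Astar\<close>.\<close>

lemma and_iterate_eq_sgd:
  assumes Ast: "Ast \<in> carrier_mat w D"
    and inj: "\<And>v. v \<in> carrier_vec D \<Longrightarrow> Ast *\<^sub>v v = 0\<^sub>v w \<Longrightarrow> v = 0\<^sub>v D"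
    and M: "M \<in> carrier_mat D D" and MG: "M * G = 1\<^sub>m D" and GM: "G * M = 1\<^sub>m D"
  shows "and_iterate (map_pmf (\<lambda>x. Ast *\<^sub>v x) \<mu>) (1 / 4) \<eta> (Ast * M) t = map_pmf (\<lambda>N. Ast * N) (sgd \<mu> z \<eta> M t)"
proof (induction t)
  case 0
  show ?case by simp
next
  case (Suc t)
  have AM: "Ast * M \<in> carrier_mat w D" using Ast M by simp
  have injAM: "v = 0\<^sub>v D" if v: "v \<in> carrier_vec D" and 0: "(Ast * M) *\<^sub>v v = 0\<^sub>v w" for v
  proof -
    have Mv: "M *\<^sub>v v \<in> carrier_vec D" using M v by simp
    have "Ast *\<^sub>v (M *\<^sub>v v) = 0\<^sub>v w" using 0 assoc_mult_mat_vec[OF Ast M v] by simp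
    then have "M *\<^sub>v v = 0\<^sub>v D" by (rule inj[OF Mv])
    then have "G *\<^sub>v (M *\<^sub>v v) = 0\<^sub>v D" using G by auto
    then show ?thesis using assoc_mult_mat_vec[OF G M v] GM v by simp
  qed
  let ?Q = "pinv (Ast * M)"
  have Q: "?Q \<in> carrier_mat D w" and QAM: "?Q * (Ast * M) = 1\<^sub>m D"
    using pinv_left_inverse[OF AM injAM] by auto
  have QA: "?Q * Ast \<in> carrier_mat D D" using Q Ast by simp
  have "?Q * Ast = ?Q * Ast * (M * G)" unfolding MG by (rule right_mult_one_mat[OF QA, symmetric])
  also have "\<dots> = ?Q * Ast * M * G" using assoc_mult_mat[OF QA M G] by simp
  also have "\<dots> = G" using assoc_mult_mat[OF Q Ast M] QAM G by simp
  finally have QAG: "?Q * Ast = G" .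
  have dec: "thresh (1 / 4) (?Q *\<^sub>v (Ast *\<^sub>v x)) = z x" if "x \<in> set_pmf \<mu>" for x
    using assoc_mult_mat_vec[OF Q Ast x_dim[OF that]] QAG by (simp add: z_def)
  have step: "Ast * N + \<eta> \<cdot>\<^sub>m outer (Ast *\<^sub>v x - Ast * N *\<^sub>v z x) (z x)
      = Ast * (N + \<eta> \<cdot>\<^sub>m outer (x - N *\<^sub>v z x) (z x))"
    if N: "N \<in> carrier_mat D D" and x: "x \<in> set_pmf \<mu>" for N x
  proof -
    have xD: "x \<in> carrier_vec D" and zD: "z x \<in> carrier_vec D" using x_dim[OF x] z_dim by auto
    have Nz: "N *\<^sub>v z x \<in> carrier_vec D" using N zD by simp
    have u: "x - N *\<^sub>v z x \<in> carrier_vec D" by (rule minus_carrier_vec[OF xD Nz])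
    note o = outer_carrier[OF u zD]
    have "Ast *\<^sub>v x - Ast * N *\<^sub>v z x = Ast *\<^sub>v (x - N *\<^sub>v z x)"
      using assoc_mult_mat_vec[OF Ast N zD] mult_minus_distrib_mat_vec[OF Ast xD Nz] by simp
    then have "\<eta> \<cdot>\<^sub>m outer (Ast *\<^sub>v x - Ast * N *\<^sub>v z x) (z x) = Ast * (\<eta> \<cdot>\<^sub>m outer (x - N *\<^sub>v z x) (z x))"
      using mult_outer[OF Ast u zD] mult_smult_distrib[OF Ast o] by simp
    then show ?thesis using mult_add_distrib_mat[OF Ast N smult_carrier_mat[OF o]] by simp
  qed
  let ?Y = "map_pmf (\<lambda>x. Ast *\<^sub>v x) \<mu>"
  have "and_iterate ?Y (1 / 4) \<eta> (Ast * M) (Suc t) =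
    bind_pmf (sgd \<mu> z \<eta> M t) (\<lambda>N. map_pmf (\<lambda>x. let u = thresh (1 / 4) (?Q *\<^sub>v (Ast *\<^sub>v x)) in
      Ast * N + \<eta> \<cdot>\<^sub>m outer (Ast *\<^sub>v x - Ast * N *\<^sub>v u) u) \<mu>)"
    by (simp only: and_iterate.simps Suc.IH) (simp add: map_pmf_def Let_def bind_assoc_pmf bind_return_pmf)
  also have "\<dots> = bind_pmf (sgd \<mu> z \<eta> M t) (\<lambda>N. map_pmf (\<lambda>x. Ast * (N + \<eta> \<cdot>\<^sub>m outer (x - N *\<^sub>v z x) (z x))) \<mu>)"
  proof (intro bind_pmf_cong map_pmf_cong refl)
    fix N x assume N: "N \<in> set_pmf (sgd \<mu> z \<eta> M t)" and x: "x \<in> set_pmf \<mu>"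
    have "N \<in> carrier_mat D D" using sgd_carrier[of \<mu> D z D M N] x_dim z_dim M N by blast
    then show "(let u = thresh (1 / 4) (?Q *\<^sub>v (Ast *\<^sub>v x)) in Ast * N + \<eta> \<cdot>\<^sub>m outer (Ast *\<^sub>v x - Ast * N *\<^sub>v u) u)
      = Ast * (N + \<eta> \<cdot>\<^sub>m outer (x - N *\<^sub>v z x) (z x))"
      using dec[OF x] step[OF _ x] by (simp add: Let_def)
  qed
  also have "\<dots> = map_pmf (\<lambda>N. Ast * N) (sgd \<mu> z \<eta> M (Suc t))"
    by (simp add: map_bind_pmf map_pmf_comp)
  finally show ?case .
qed

end

text \<open>The invariant between stages: \<open>d\<close> halves while \<open>c\<close> grows but
  stays below \<open>1/2\<close>. The events for the algorithm are the images of this set under left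
  multiplication by \<open>Astar\<close>.\<close>

definition near_diag :: "nat \<Rightarrow> real \<Rightarrow> real \<Rightarrow> real mat set" where
  "near_diag n c d = {M \<in> carrier_mat n n. (\<forall>i<n. \<bar>M $$ (i, i) - 1\<bar> \<le> c) \<and> op_le (off_part M) d}"

lemma near_diag_mono: "N \<in> near_diag n c d \<Longrightarrow> c \<le> c' \<Longrightarrow> N \<in> near_diag n c' d"
  by (auto simp: near_diag_def intro: order_trans)

context binary_gcc
begin

text \<open>With probability \<open>1 - p\<close> the last iterate is within \<open>\<delta>\<close>
  of the minimiser, which is within \<open>12 d / 2000\<close> of the diagonal matrix of reciprocals
  of \<open>G_ii\<close>. These are within \<open>18 d\<close> of the old diagonal entries, and
  \<open>18 d + d / 8 \<le> 19 d\<close> bounds the drift.\<close>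

lemma stage_prob:
  assumes Ast: "Ast \<in> carrier_mat w D"
    and inj: "\<And>v. v \<in> carrier_vec D \<Longrightarrow> Ast *\<^sub>v v = 0\<^sub>v w \<Longrightarrow> v = 0\<^sub>v D"
    and m_le: "m \<le> 1 / (2 * 10 ^ 20) * (k * real D * lam ^ 4 / r ^ 5)"
    and \<rho>: "\<rho> = k * lam / (16 * D)"
    and p: "0 < p" "p \<le> 1" and \<delta>: "0 < \<delta>" "\<delta> \<le> d / 16"
    and \<eta>: "\<eta> = \<rho> * p * \<delta>\<^sup>2 / (36 * (real D)\<^sup>2)"
    and n: "0 < n" "2 * D / (\<eta> * \<rho> * p * \<delta>\<^sup>2) \<le> real n"
    and M: "M \<in> near_diag D c d" and c: "c \<le> 1 / 2" and d: "d \<le> 1 / 200"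
  shows "measure_pmf.prob (and_iterate (map_pmf (\<lambda>x. Ast *\<^sub>v x) \<mu>) (1 / 4) \<eta> (Ast * M) n)
    ((\<lambda>N. Ast * N) ` near_diag D (c + 19 * d) (d / 2)) \<ge> 1 - p"
proof -
  have Mc: "M \<in> carrier_mat D D" and Md: "\<And>i. i < D \<Longrightarrow> \<bar>M $$ (i, i) - 1\<bar> \<le> c" and Mo: "op_le (off_part M) d"
    using M by (auto simp: near_diag_def)
  have d0: "0 < d" using \<delta> by simp
  have "\<exists>G \<in> carrier_mat D D. M * G = 1\<^sub>m D \<and> G * M = 1\<^sub>m D \<and> op_le G 3 \<and>
    decoding D r k m lam \<mu> G (12 * d) \<and> (\<forall>i<D. \<bar>1 / G $$ (i, i) - M $$ (i, i)\<bar> \<le> 18 * d)"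
    by (rule decoding_inverse[OF Mc _ Mo]) (use Md c d d0 m_le in fastforce)+
  then obtain G where G: "G \<in> carrier_mat D D" and MG: "M * G = 1\<^sub>m D" and GM: "G * M = 1\<^sub>m D"
    and G3: "op_le G 3" and dec: "decoding D r k m lam \<mu> G (12 * d)"
    and Gd: "\<And>i. i < D \<Longrightarrow> \<bar>1 / G $$ (i, i) - M $$ (i, i)\<bar> \<le> 18 * d" by blast
  interpret dec: decoding D r k m lam \<mu> G "12 * d" by (rule dec)
  define Sg where "Sg = mat_diag D (\<lambda>i. 1 / G $$ (i, i))"
  have Sg: "Sg \<in> carrier_mat D D" by (simp add: Sg_def)
  obtain Mst where Mst: "Mst \<in> carrier_mat D D"
    and orth: "\<And>i j. i < D \<Longrightarrow> j < D \<Longrightarrow> E (\<lambda>x. (x $ i - (\<Sum>l<D. Mst $$ (i, l) * dec.z x $ l)) * dec.z x $ j) = 0"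
    and opMst: "op_le (Mst - Sg) (12 * d / 2000)"
    using dec.regression_exists unfolding Sg_def by blast
  have Q: "Mst - Sg \<in> carrier_mat D D" by (rule minus_carrier_mat[OF Sg])
  \<comment> \<open>Initial distance to the minimiser: \<open>18 d\<close> from the diagonal,
    \<open>d\<close> from the off-diagonal part and \<open>12 d / 2000\<close> from the regression.
    It is at most 1, so the squared Frobenius distance is at most \<open>D\<close>, as
    \<open>sgd_prob\<close> expects.\<close>
  have "op_le (mat_diag D (\<lambda>i. M $$ (i, i) - 1 / G $$ (i, i)) + off_part M - (Mst - Sg)) (18 * d + d + 12 * d / 2000)"
  proof (rule op_le_diff[OF op_le_add[OF op_le_mat_diag Mo mat_diag_dim off_part_carrier[OF Mc]] opMst _ Q])
    fix i assume "i < D"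
    then show "\<bar>M $$ (i, i) - 1 / G $$ (i, i)\<bar> \<le> 18 * d" using Gd[of i] by (simp add: abs_minus_commute)
  qed (use d0 Mc in auto)
  moreover have "mat_diag D (\<lambda>i. M $$ (i, i) - 1 / G $$ (i, i)) + off_part M - (Mst - Sg) = M - Mst"
    using Mc Mst Sg by (intro eq_matI) (auto simp: Sg_def mat_diag_def off_part_def)
  ultimately have "op_le (M - Mst) (18 * d + d + 12 * d / 2000)" by simp
  then have "op_le (M - Mst) 1" by (rule op_le_mono) (use d in simp)
  then have frobM: "frob (M - Mst) \<le> D"
    using op_le_frobenius_sum[of "M - Mst" 1 D D] minus_carrier_mat[OF Mst] Mst by (simp add: frob_def)
  have "1 - p \<le> measure_pmf.prob (sgd \<mu> dec.z \<eta> M n) {N. N \<in> carrier_mat D D \<and> op_le (N - Mst) \<delta>}"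
  proof (rule dec.sgd_prob[OF Mst orth _ \<rho> p \<delta>(1) _ \<eta> n Mc frobM])
    show "(\<Sum>i<D. (dec.z x $ i)\<^sup>2) \<le> 9 * D" if "x \<in> set_pmf \<mu>" for x
      using dec.z_sq_sum_le[OF G3 _ that] by simp
    show "\<delta> \<le> 1" using \<delta> d by simp
  qed
  also have "\<dots> \<le> measure_pmf.prob (sgd \<mu> dec.z \<eta> M n) ((\<lambda>N. Ast * N) -` ((\<lambda>N. Ast * N) ` near_diag D (c + 19 * d) (d / 2)))"
  proof (rule measure_pmf.finite_measure_mono)
    show "{N. N \<in> carrier_mat D D \<and> op_le (N - Mst) \<delta>} \<subseteq> (\<lambda>N. Ast * N) -` ((\<lambda>N. Ast * N) ` near_diag D (c + 19 * d) (d / 2))"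
    proof (rule subsetI)
      fix N assume "N \<in> {N. N \<in> carrier_mat D D \<and> op_le (N - Mst) \<delta>}"
      then have N: "N \<in> carrier_mat D D" and opN: "op_le (N - Mst) \<delta>" by auto
      have NS: "N - Sg \<in> carrier_mat D D" by (rule minus_carrier_mat[OF Sg])
      have "op_le (N - Mst + (Mst - Sg)) (\<delta> + 12 * d / 2000)"
        by (rule op_le_add[OF opN opMst minus_carrier_mat[OF Mst] Q])
      moreover have "N - Mst + (Mst - Sg) = N - Sg"
        using N Mst Sg by (intro eq_matI) auto
      \<comment> \<open>\<open>\<delta> \<le> d / 16\<close>, and \<open>12 d / 2000\<close> is
        smaller than \<open>d / 16\<close>. Removing the diagonal at most doubles
        \<open>d / 8\<close>, which stays below \<open>d / 2\<close>.\<close>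
      ultimately have opNS: "op_le (N - Sg) (d / 8)"
        using \<delta> d0 by (auto intro: op_le_mono)
      have "off_part N = off_part (N - Sg)"
        using N Sg by (intro eq_matI) (auto simp: off_part_def Sg_def mat_diag_def)
      then have "op_le (off_part N) (d / 2)"
        using op_le_off_part[OF opNS NS] d0 by (auto intro: op_le_mono)
      moreover have "\<bar>N $$ (i, i) - 1\<bar> \<le> c + 19 * d" if i: "i < D" for i
      proof -
        have "\<bar>(N - Sg) $$ (i, i)\<bar> \<le> d / 8"
          using op_le_entry[OF opNS NS i i] d0 by simp
        then have "\<bar>N $$ (i, i) - 1 / G $$ (i, i)\<bar> \<le> d / 8"
          using i N by (simp add: Sg_def mat_diag_def)
        then show ?thesis using Gd[OF i] Md[OF i] d0 by linarith
      qed
      ultimately have "N \<in> near_diag D (c + 19 * d) (d / 2)"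
        using N by (simp add: near_diag_def)
      then show "N \<in> (\<lambda>N. Ast * N) -` ((\<lambda>N. Ast * N) ` near_diag D (c + 19 * d) (d / 2))" by blast
    qed
  qed simp
  finally show ?thesis
    by (simp add: dec.and_iterate_eq_sgd[OF Ast inj Mc MG GM] measure_map_pmf)
qed

text \<open>The drifts \<open>19 d, 19 d / 2, 19 d / 4, ...\<close> sum to
  \<open>38 d (1 - 2^-s)\<close>, and failures add up to \<open>s p\<close>. All stages share one
  \<open>\<eta>\<close> and one length, so \<open>\<delta>\<close> is fixed in advance by the
  smallest \<open>d\<close>; it is then small enough for the earlier stages too.\<close>

lemma AND_prob:
  assumes Ast: "Ast \<in> carrier_mat w D"
    and inj: "\<And>v. v \<in> carrier_vec D \<Longrightarrow> Ast *\<^sub>v v = 0\<^sub>v w \<Longrightarrow> v = 0\<^sub>v D"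
    and m_le: "m \<le> 1 / (2 * 10 ^ 20) * (k * real D * lam ^ 4 / r ^ 5)"
    and \<rho>: "\<rho> = k * lam / (16 * D)"
    and p: "0 < p" "p \<le> 1" and \<delta>: "0 < \<delta>"
    and \<eta>: "\<eta> = \<rho> * p * \<delta>\<^sup>2 / (36 * (real D)\<^sup>2)"
    and n: "2 * D / (\<eta> * \<rho> * p * \<delta>\<^sup>2) \<le> real (Suc T)"
  shows "M \<in> near_diag D c d \<Longrightarrow> \<delta> \<le> d / (16 * 2 ^ s) \<Longrightarrow> c + 38 * d * (1 - 1 / 2 ^ s) \<le> 1 / 2 \<Longrightarrow> d \<le> 1 / 200 \<Longrightarrow>
    measure_pmf.prob (AND (map_pmf (\<lambda>x. Ast *\<^sub>v x) \<mu>) T \<eta> (replicate s (1 / 4)) (Ast * M))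
      ((\<lambda>N. Ast * N) ` near_diag D (c + 38 * d * (1 - 1 / 2 ^ s)) (d / 2 ^ s)) \<ge> 1 - real s * p"
proof (induction s arbitrary: M c d)
  case 0
  then show ?case by (simp add: measure_pmf_single indicator_def)
next
  case (Suc s)
  let ?Y = "map_pmf (\<lambda>x. Ast *\<^sub>v x) \<mu>"
  have "0 < d / (16 * 2 ^ Suc s)" using Suc.prems(2) \<delta> by linarith
  then have d0: "0 < d" by (simp add: zero_less_divide_iff)
  have pw: "1 \<le> (2::real) ^ s" by (rule one_le_power) simp
  have "16 * 1 \<le> 16 * (2::real) ^ Suc s" by (intro mult_left_mono one_le_power) auto
  then have "d / (16 * 2 ^ Suc s) \<le> d / (16 * 1)"
    by (rule divide_left_mono) (use d0 pw in auto)
  then have \<delta>1: "\<delta> \<le> d / 16" using Suc.prems(2) by simp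
  have "1 / 2 ^ Suc s \<le> 1 / (1::real)"
    by (intro frac_le one_le_power) simp_all
  then have "0 \<le> 38 * d * (1 - 1 / 2 ^ Suc s)"
    using d0 by (intro mult_nonneg_nonneg) linarith+
  then have c: "c \<le> 1 / 2" using Suc.prems(3) by linarith
  have eq: "c + 19 * d + 38 * (d / 2) * (1 - 1 / 2 ^ s) = c + 38 * d * (1 - 1 / 2 ^ Suc s)"
    by (simp add: field_simps)
  have "1 - p - real s * p \<le> measure_pmf.prob (bind_pmf (and_iterate ?Y (1 / 4) \<eta> (Ast * M) (Suc T)) (AND ?Y T \<eta> (replicate s (1 / 4))))
      ((\<lambda>N. Ast * N) ` near_diag D (c + 38 * d * (1 - 1 / 2 ^ Suc s)) (d / 2 ^ Suc s))"
  proof (rule prob_bind_ge)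
    show "1 - p \<le> measure_pmf.prob (and_iterate ?Y (1 / 4) \<eta> (Ast * M) (Suc T)) ((\<lambda>N. Ast * N) ` near_diag D (c + 19 * d) (d / 2))"
      by (rule stage_prob[OF Ast inj m_le \<rho> p \<delta> \<delta>1 \<eta> _ n Suc.prems(1) c Suc.prems(4)]) simp_all
  next
    fix A assume "A \<in> (\<lambda>N. Ast * N) ` near_diag D (c + 19 * d) (d / 2)"
    then obtain N where A: "A = Ast * N" and N: "N \<in> near_diag D (c + 19 * d) (d / 2)" by blast
    have "1 - real s * p \<le> measure_pmf.prob (AND ?Y T \<eta> (replicate s (1 / 4)) (Ast * N))
      ((\<lambda>N. Ast * N) ` near_diag D (c + 19 * d + 38 * (d / 2) * (1 - 1 / 2 ^ s)) (d / 2 / 2 ^ s))"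
    proof (rule Suc.IH[OF N])
      show "\<delta> \<le> d / 2 / (16 * 2 ^ s)" using Suc.prems(2) by (simp add: field_simps)
      show "c + 19 * d + 38 * (d / 2) * (1 - 1 / 2 ^ s) \<le> 1 / 2" unfolding eq by (rule Suc.prems(3))
      show "d / 2 \<le> 1 / 200" using Suc.prems(4) d0 by simp
    qed
    then show "1 - real s * p \<le> measure_pmf.prob (AND ?Y T \<eta> (replicate s (1 / 4)) A)
      ((\<lambda>N. Ast * N) ` near_diag D (c + 38 * d * (1 - 1 / 2 ^ Suc s)) (d / 2 ^ Suc s))"
      unfolding A eq by (simp add: mult.commute)
  qed (use p in auto)
  then show ?case by (simp add: algebra_simps)
qed

end

section \<open>Choice of the parameters\<close>

lemma le_const_power:
  fixes K X :: real and C a :: nat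
  assumes "y \<le> K * X ^ a" "K \<le> real C" "a \<le> C" "1 \<le> X" "0 \<le> K"
  shows "y \<le> real C * X ^ C"
proof -
  have "K * X ^ a \<le> real C * X ^ C"
    using assms by (intro mult_mono power_increasing) auto
  then show ?thesis using assms by linarith
qed

lemma log2_le_ln: "1 \<le> U \<Longrightarrow> log 2 U \<le> 2 * ln U"
proof -
  assume U: "1 \<le> U"
  have "exp (1 / 2 :: real) ^ 2 \<le> 2 ^ 2"
    using exp_le by (simp flip: exp_of_nat_mult)
  then have "exp (1 / 2 :: real) \<le> 2" by (rule power2_le_imp_le) simp
  then have "1 / 2 \<le> ln (2 :: real)" by (simp only: ln_ge_iff zero_less_numeral)
  then have "ln U * (1 / 2) \<le> ln U * ln 2" using U by (intro mult_left_mono) auto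
  then show ?thesis by (simp add: log_def field_simps)
qed

text \<open>The lower bound on \<open>2 ^ s\<close> is for the final accuracy, as
  \<open>L / \<epsilon> \<le> U^2\<close> in the application. The upper bound keeps
  \<open>1 / \<delta>\<close>, which is proportional to \<open>2 ^ s\<close>, polynomial.\<close>

lemma stage_count:
  fixes U :: real
  assumes U: "1 \<le> U" and s: "s = nat \<lceil>2 * log 2 U\<rceil> + 1"
  shows "1 \<le> s" "real s \<le> 4 * (1 + ln U)" "U\<^sup>2 \<le> 2 ^ s" "2 ^ s \<le> 4 * U\<^sup>2"
proof -
  have l0: "0 \<le> log 2 U" using U by simp
  have lo: "2 * log 2 U \<le> real s" and up: "real s \<le> 2 * log 2 U + 2"
    using l0 unfolding s by linarith+
  show "1 \<le> s" by (simp add: s)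
  show "real s \<le> 4 * (1 + ln U)" using up log2_le_ln[OF U] by simp
  have U2: "2 powr (2 * log 2 U) = U\<^sup>2"
    unfolding mult_2 powr_add using U by (simp add: power2_eq_square)
  have s2: "2 ^ s = 2 powr real s" by (simp add: powr_realpow)
  show "U\<^sup>2 \<le> 2 ^ s" unfolding s2 U2[symmetric] using lo by (intro powr_mono) auto
  have "2 powr real s \<le> 2 powr (2 * log 2 U + 2)" using up by (intro powr_mono) auto
  also have "\<dots> = 4 * U\<^sup>2" unfolding powr_add U2 by simp
  finally show "2 ^ s \<le> 4 * U\<^sup>2" unfolding s2 .
qed

text \<open>The choices depend on one another in the order \<open>s\<close>, \<open>p\<close>,
  \<open>\<delta>\<close>, \<open>\<eta>\<close>, \<open>T\<close>: the failure budget
  \<open>1 / X^q\<close> is shared equally by the stages, \<open>\<delta>\<close> matches the last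
  stage, and \<open>\<eta>\<close> and \<open>T\<close> are dictated by
  \<open>sgd_prob\<close>.\<close>

lemma parameters_exist:
  fixes q :: nat
  defines "C \<equiv> 2 * q + 20 + 10 ^ 30"
  fixes D :: nat and \<epsilon> k lam L X :: real
  assumes D: "0 < D" and pos: "0 < \<epsilon>" "0 < k" "0 < lam" "0 \<le> L"
    and X: "X = real D + 1 / \<epsilon> + 1 / k + 1 / lam + L"
    and \<rho>: "\<rho> = k * lam / (16 * D)"
  shows "\<exists>T s \<eta> p \<delta>. real T \<le> real C * X ^ C \<and> 0 < \<eta> \<and> 1 / \<eta> \<le> real C * X ^ C \<and>
    1 \<le> s \<and> real s \<le> real C * (1 + ln (real D + 1 / \<epsilon> + L)) ^ C \<and>
    real (s * (T + 1)) \<le> real C * X ^ C \<and>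
    0 < p \<and> p \<le> 1 \<and> real s * p = 1 / X ^ q \<and> 0 < \<delta> \<and> \<delta> = (1 / 200) / (16 * 2 ^ s) \<and>
    \<eta> = \<rho> * p * \<delta>\<^sup>2 / (36 * (real D)\<^sup>2) \<and> 2 * D / (\<eta> * \<rho> * p * \<delta>\<^sup>2) \<le> real (Suc T) \<and>
    L * ((1 / 200) / 2 ^ s) \<le> \<epsilon>"
proof -
  \<comment> \<open>Omits \<open>1 / k\<close> and \<open>1 / lam\<close>, so that the number of
    stages is polylogarithmic in the remaining quantities; only step size and stage length depend on
    the full \<open>X\<close>.\<close>
  define U where "U = real D + 1 / \<epsilon> + L"
  have D1: "1 \<le> real D" using D by simp
  have U1: "1 \<le> U" and UX: "U \<le> X" and DX: "real D \<le> X" and kX: "1 / k \<le> X" and lX: "1 / lam \<le> X"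
    using D1 pos by (simp_all add: U_def X add_increasing2)
  have X1: "1 \<le> X" using U1 UX by simp
  define s where "s = nat \<lceil>2 * log 2 U\<rceil> + 1"
  note sb = stage_count[OF U1 s_def]
  have s0: "0 < real s" using sb(1) by simp
  have "ln U \<le> U - 1" using U1 ln_le_minus_one[of U] by simp
  then have sX: "real s \<le> 4 * X" using sb(2) UX by simp
  define p where "p = 1 / (real s * X ^ q)"
  have Xq: "1 \<le> X ^ q" by (rule one_le_power[OF X1])
  have p0: "0 < p" using s0 Xq by (simp add: p_def)
  have "1 * 1 \<le> real s * X ^ q" using sb(1) Xq by (intro mult_mono) auto
  then have p1: "p \<le> 1" by (simp add: p_def)
  have sp: "real s * p = 1 / X ^ q" using s0 by (simp add: p_def)
  have P: "1 / p \<le> 4 * X ^ (q + 1)"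
    using sX Xq by (simp add: p_def mult_right_mono mult.assoc)
  define \<delta> :: real where "\<delta> = (1 / 200) / (16 * 2 ^ s)"
  have \<delta>0: "0 < \<delta>" by (simp add: \<delta>_def)
  have "U\<^sup>2 \<le> X\<^sup>2" using U1 UX by (intro power_mono) auto
  then have "1 / \<delta> \<le> 12800 * X\<^sup>2" using sb(4) by (simp add: \<delta>_def)
  then have "(1 / \<delta>)\<^sup>2 \<le> (12800 * X\<^sup>2)\<^sup>2" using \<delta>0 by (intro power_mono) auto
  then have Dl: "1 / \<delta>\<^sup>2 \<le> 163840000 * X ^ 4" by (simp add: power_divide power_mult_distrib flip: power_mult)
  have \<rho>0: "0 < \<rho>" using D pos by (simp add: \<rho>)
  have R: "1 / \<rho> \<le> 16 * X ^ 3"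
  proof -
    have "1 / \<rho> = 16 * (real D * (1 / k * (1 / lam)))" using D pos by (simp add: \<rho> field_simps)
    also have "\<dots> \<le> 16 * (X * (X * X))"
      using DX kX lX pos X1 by (intro mult_left_mono mult_mono) auto
    finally show ?thesis by (simp add: power3_eq_cube mult.assoc)
  qed
  \<comment> \<open>These collect the factors of \<open>R\<close>, \<open>P\<close> and
    \<open>Dl\<close>; there \<open>12800 = 200 * 16 * 4\<close> and
    \<open>163840000 = 12800^2\<close>. The largest coefficient, \<open>4 * (K2 + 2)\<close>, is of
    order \<open>10^22\<close>, hence covered by the \<open>10 ^ 30\<close> in
    \<open>C\<close>.\<close>
  define K1 :: real where "K1 = 36 * (16 * (4 * 163840000))"
  define K2 :: real where "K2 = 2 * (K1 * (16 * (4 * 163840000)))"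
  define \<eta> where "\<eta> = \<rho> * p * \<delta>\<^sup>2 / (36 * (real D)\<^sup>2)"
  have \<eta>0: "0 < \<eta>" using \<rho>0 p0 \<delta>0 D by (simp add: \<eta>_def)
  have Rpd: "1 / \<rho> * (1 / p * (1 / \<delta>\<^sup>2)) \<le> 16 * X ^ 3 * (4 * X ^ (q + 1) * (163840000 * X ^ 4))"
    using R P Dl \<rho>0 p0 \<delta>0 X1 by (intro mult_mono) auto
  have H: "1 / \<eta> \<le> K1 * X ^ (q + 10)"
  proof -
    have "1 / \<eta> = 36 * (real D)\<^sup>2 * (1 / \<rho> * (1 / p * (1 / \<delta>\<^sup>2)))" by (simp add: \<eta>_def)
    also have "\<dots> \<le> 36 * X\<^sup>2 * (16 * X ^ 3 * (4 * X ^ (q + 1) * (163840000 * X ^ 4)))"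
      using DX \<rho>0 p0 X1 by (intro mult_mono[OF _ Rpd] mult_left_mono power_mono) auto
    also have "\<dots> = K1 * X ^ (q + 10)"
      unfolding K1_def by (simp add: power_add power_numeral_reduce)
    finally show ?thesis .
  qed
  define Tr where "Tr = 2 * real D / (\<eta> * \<rho> * p * \<delta>\<^sup>2)"
  have Tr0: "0 \<le> Tr" using \<eta>0 \<rho>0 p0 by (simp add: Tr_def)
  have TrX: "Tr \<le> K2 * X ^ (2 * q + 19)"
  proof -
    have "Tr = 2 * real D * (1 / \<eta> * (1 / \<rho> * (1 / p * (1 / \<delta>\<^sup>2))))" by (simp add: Tr_def)
    also have "\<dots> \<le> 2 * X * (K1 * X ^ (q + 10) * (16 * X ^ 3 * (4 * X ^ (q + 1) * (163840000 * X ^ 4))))"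
      using DX \<rho>0 p0 \<eta>0 X1 by (intro mult_mono[OF _ mult_mono[OF H Rpd]]) (auto simp: K1_def)
    also have "\<dots> = K2 * X ^ (2 * q + 19)"
      unfolding K2_def by (simp add: power_add power_numeral_reduce power_even_eq power2_eq_square)
    finally show ?thesis .
  qed
  define T where "T = nat \<lceil>Tr\<rceil>"
  have T1: "Tr \<le> real T" "real T \<le> Tr + 1" using Tr0 unfolding T_def by linarith+
  have one: "1 \<le> X ^ (2 * q + 19)" by (rule one_le_power[OF X1])
  have TX: "real T \<le> (K2 + 1) * X ^ (2 * q + 19)"
    using T1 TrX one by (simp add: algebra_simps)
  have T2: "real T + 1 \<le> (K2 + 2) * X ^ (2 * q + 19)"
    using TX one unfolding distrib_right by linarith
  have "real (s * (T + 1)) = real s * (real T + 1)" by (simp add: algebra_simps)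
  also have "\<dots> \<le> 4 * X * ((K2 + 2) * X ^ (2 * q + 19))"
    using X1 by (intro mult_mono[OF sX T2]) auto
  also have "\<dots> = (4 * (K2 + 2)) * X ^ (2 * q + 20)" by (simp add: power_add power_numeral_reduce)
  finally have sT: "real (s * (T + 1)) \<le> (4 * (K2 + 2)) * X ^ (2 * q + 20)" .
  have C: "K1 \<le> real C" "K2 + 1 \<le> real C" "4 * (K2 + 2) \<le> real C" "4 \<le> real C"
    unfolding K2_def K1_def C_def by simp_all
  have Cq: "q + 10 \<le> C" "2 * q + 19 \<le> C" "2 * q + 20 \<le> C" "1 \<le> C"
    by (simp_all add: C_def)
  have "1 + ln U \<le> (1 + ln U) ^ C"
    using U1 power_increasing[OF Cq(4), of "1 + ln U"] by simp
  then have "4 * (1 + ln U) \<le> real C * (1 + ln U) ^ C"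
    using C(4) U1 by (intro mult_mono) auto
  then have sC: "real s \<le> real C * (1 + ln U) ^ C" using sb(2) by linarith
  have LU: "L * ((1 / 200) / 2 ^ s) \<le> \<epsilon>"
  proof -
    have "L * (1 / \<epsilon>) \<le> U * U"
      using pos D1 by (intro mult_mono) (auto simp: U_def)
    also have "\<dots> \<le> 2 ^ s" using sb(3) by (simp add: power2_eq_square)
    finally have "L \<le> \<epsilon> * 2 ^ s" using pos by (simp add: field_simps)
    moreover have "0 \<le> \<epsilon> * 2 ^ s" using pos by simp
    ultimately have "L \<le> 200 * (\<epsilon> * 2 ^ s)" by linarith
    then show ?thesis by (simp add: field_simps)
  qed
  have K0: "0 \<le> K1" "0 \<le> K2" by (simp_all add: K1_def K2_def)
  have "real T \<le> real C * X ^ C" by (rule le_const_power[OF TX C(2) Cq(2) X1]) (use K0 in simp)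
  moreover have "1 / \<eta> \<le> real C * X ^ C" by (rule le_const_power[OF H C(1) Cq(1) X1 K0(1)])
  moreover have "real (s * (T + 1)) \<le> real C * X ^ C" by (rule le_const_power[OF sT C(3) Cq(3) X1]) (use K0 in simp)
  moreover have "2 * D / (\<eta> * \<rho> * p * \<delta>\<^sup>2) \<le> real (Suc T)" using T1 by (simp add: Tr_def)
  ultimately show ?thesis
    using \<eta>0 sb(1) sC p0 p1 sp \<delta>0 \<delta>_def \<eta>_def LU unfolding U_def by blast
qed

section \<open>From the factor to the output guarantee\<close>

lemma loewner_ge_mat_diag:
  assumes "\<And>i. i < n \<Longrightarrow> c \<le> f i"
  shows "loewner_ge (mat_diag n f) (c \<cdot>\<^sub>m 1\<^sub>m n)"
proof -
  have eq: "mat_diag n f - c \<cdot>\<^sub>m 1\<^sub>m n = mat_diag n (\<lambda>i. f i - c)"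
    by (intro eq_matI) (auto simp: mat_diag_def)
  have "0 \<le> v \<bullet> (mat_diag n (\<lambda>i. f i - c) *\<^sub>v v)" if v: "v \<in> carrier_vec n" for v
  proof -
    have "(mat_diag n (\<lambda>i. f i - c) *\<^sub>v v) $ i = (f i - c) * v $ i" if "i < n" for i
    proof -
      have "(mat_diag n (\<lambda>i. f i - c) *\<^sub>v v) $ i = (\<Sum>j<n. if j = i then (f i - c) * v $ i else 0)"
        unfolding mult_mat_vec_sum[OF mat_diag_dim v that] using that by (intro sum.cong) (auto simp: mat_diag_def)
      then show ?thesis using that by simp
    qed
    then have "v \<bullet> (mat_diag n (\<lambda>i. f i - c) *\<^sub>v v) = (\<Sum>i<n. v $ i * ((f i - c) * v $ i))"
      unfolding scalar_prod_sum[OF mult_mat_vec_carrier[OF mat_diag_dim v]] by (intro sum.cong) auto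
    also have "\<dots> = (\<Sum>i<n. (f i - c) * (v $ i)\<^sup>2)" by (intro sum.cong) (auto simp: power2_eq_square)
    also have "0 \<le> \<dots>" using assms by (intro sum_nonneg) auto
    finally show ?thesis .
  qed
  moreover have "transpose_mat (mat_diag n (\<lambda>i. f i - c)) = mat_diag n (\<lambda>i. f i - c)"
    by (intro eq_matI) (auto simp: mat_diag_def)
  ultimately show ?thesis unfolding loewner_ge_def eq psd_def by (auto simp: mat_diag_def)
qed

text \<open>Taking the diagonal of \<open>N\<close> as the scaling leaves
  \<open>Astar * off_part N\<close> as the error. Here the norm bound \<open>L\<close> converts the
  accuracy of the factor into that of the output.\<close>

lemma near_diag_output:
  assumes Ast: "Ast \<in> carrier_mat w n" and L: "spec_norm Ast \<le> L" "0 \<le> L" and d: "0 \<le> d" "L * d \<le> \<epsilon>"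
    and N: "N \<in> near_diag n (1 / 2) d"
  shows "\<exists>S \<in> carrier_mat n n. diagonal_mat S \<and> loewner_ge S ((1 / 2) \<cdot>\<^sub>m 1\<^sub>m n) \<and>
    spec_norm (Ast * N - Ast * S) \<le> \<epsilon>"
proof -
  define S where "S = mat_diag n (\<lambda>i. N $$ (i, i))"
  have S: "S \<in> carrier_mat n n" by (simp add: S_def)
  have Nc: "N \<in> carrier_mat n n" and Nd: "\<And>i. i < n \<Longrightarrow> \<bar>N $$ (i, i) - 1\<bar> \<le> 1 / 2" and No: "op_le (off_part N) d"
    using N by (auto simp: near_diag_def)
  have "N - S = off_part N" using Nc by (intro eq_matI) (auto simp: S_def mat_diag_def off_part_def)
  then have "Ast * N - Ast * S = Ast * off_part N" using mult_minus_distrib_mat[OF Ast Nc S] by simp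
  moreover have "op_le (Ast * off_part N) (L * d)"
    by (rule op_le_mult[OF spec_norm_leD[OF L(1)] No Ast off_part_carrier[OF Nc] L(2)])
  then have "spec_norm (Ast * off_part N) \<le> L * d" by (rule spec_norm_leI) (use L d in simp)
  moreover have "loewner_ge S ((1 / 2) \<cdot>\<^sub>m 1\<^sub>m n)"
    unfolding S_def
  proof (rule loewner_ge_mat_diag)
    fix i assume "i < n"
    from Nd[OF this] show "1 / 2 \<le> N $$ (i, i)" by linarith
  qed
  ultimately show ?thesis using S d by (intro bexI[of _ S]) (auto simp: S_def diagonal_mat_diag)
qed

lemma initialization_near_diag:
  assumes "initialization n l Ast A0"
  obtains M where "M \<in> near_diag n (1 / 4) l" "A0 = Ast * M"
proof -
  obtain S F where S: "S \<in> carrier_mat n n" and F: "F \<in> carrier_mat n n" and dS: "diagonal_mat S"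
    and oF: "off_diagonal_mat F" and A0: "A0 = Ast * (S + F)" and nF: "spec_norm F \<le> l"
    and nS: "spec_norm (S - 1\<^sub>m n) \<le> 1 / 4"
    using assms by (auto simp: initialization_def)
  have "off_part (S + F) = F"
    using S F dS oF by (intro eq_matI) (auto simp: off_part_def diagonal_mat_def off_diagonal_mat_def)
  then have "op_le (off_part (S + F)) l" using spec_norm_leD[OF nF] by simp
  moreover have "\<bar>(S + F) $$ (i, i) - 1\<bar> \<le> 1 / 4" if i: "i < n" for i
    using op_le_entry[OF spec_norm_leD[OF nS] minus_carrier_mat[OF one_carrier_mat] i i] i S F oF
    by (auto simp: off_diagonal_mat_def)
  ultimately have "S + F \<in> near_diag n (1 / 4) l" using S F by (simp add: near_diag_def)
  then show thesis using that A0 by blast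
qed

text \<open>The sign of \<open>m\<close> is free in the theorem, whereas the estimates multiply by
  \<open>m\<close>. Raising it to \<open>max m 0\<close> only relaxes condition (3), and the upper
  bound imposed on \<open>m\<close> is nonnegative, so it survives.\<close>

lemma gcc_max_0: "gcc D r k m lam \<mu> \<Longrightarrow> gcc D r k (max m 0) lam \<mu>"
proof -
  assume gcc: "gcc D r k m lam \<mu>"
  have "m / (real D)\<^sup>2 \<le> max m 0 / (real D)\<^sup>2" by (intro divide_right_mono) auto
  then show ?thesis using gcc unfolding gcc_def by (meson order_trans)
qed

text \<open>\<open>X\<close> is the common base of the polynomial bounds; \<open>C\<close> depends
  only on the confidence exponent \<open>q\<close>. The schedule \<open>T\<close>, \<open>s\<close>,
  \<open>\<eta>\<close> is quantified before \<open>Astar\<close>, the law of \<open>x\<close> and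
  \<open>A0\<close>, so one choice serves all instances with the same \<open>D\<close>,
  \<open>\<epsilon>\<close>, \<open>k\<close>, \<open>lam\<close> and \<open>L\<close>. The rank
  condition makes the pseudo-inverse a left inverse; \<open>L\<close> is present because the error
  is measured after multiplication by \<open>Astar\<close>.\<close>

theorem theorem1:
  shows "\<exists>l c :: real. 0 < l \<and> l < 1 \<and> 0 < c \<and>
    (\<forall>q :: nat. \<exists>C :: nat.
      \<forall>(D :: nat) (\<epsilon> :: real) (k :: real) (lam :: real) (L :: real) (X :: real).
        0 < D \<longrightarrow> 0 < \<epsilon> \<longrightarrow> 0 < k \<longrightarrow> 0 < lam \<longrightarrow> 0 \<le> L \<longrightarrow>
        X = real D + 1 / \<epsilon> + 1 / k + 1 / lam + L \<longrightarrow>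
        (\<exists>(T :: nat) (s :: nat) (\<eta> :: real).
          real T \<le> real C * X ^ C \<and>
          0 < \<eta> \<and> 1 / \<eta> \<le> real C * X ^ C \<and>
          1 \<le> s \<and> real s \<le> real C * (1 + ln (real D + 1 / \<epsilon> + L)) ^ C \<and>
          real (s * (T + 1)) \<le> real C * X ^ C \<and>
          (\<forall>(W :: nat) (Astar :: real mat) (\<mu> :: real vec pmf) (r :: real) (m :: real) (A0 :: real mat).
            Astar \<in> carrier_mat W D \<longrightarrow>
            vec_space.rank W Astar = D \<longrightarrow>
            spec_norm Astar \<le> L \<longrightarrow>
            (\<forall>x \<in> set_pmf \<mu>. x \<in> carrier_vec D \<and> (\<forall>i<D. x $ i \<in> {0, 1})) \<longrightarrow>
            gcc D r k m lam \<mu> \<longrightarrow>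
            m \<le> c * (k * real D * lam ^ 4 / r ^ 5) \<longrightarrow>
            initialization D l Astar A0 \<longrightarrow>
            measure_pmf.prob
              (AND (map_pmf (\<lambda>x. Astar *\<^sub>v x) \<mu>) T \<eta> (replicate s (1 / 4)) A0)
              {A. \<exists>S \<in> carrier_mat D D. diagonal_mat S \<and>
                    loewner_ge S ((1 / 2) \<cdot>\<^sub>m 1\<^sub>m D) \<and>
                    spec_norm (A - Astar * S) \<le> \<epsilon>}
            \<ge> 1 - 1 / X ^ q)))"
proof (rule exI[of _ "1 / 200"], rule exI[of _ "1 / (2 * 10 ^ 20)"], intro conjI allI)
  fix q :: nat
  show "\<exists>C :: nat.
      \<forall>(D :: nat) (\<epsilon> :: real) (k :: real) (lam :: real) (L :: real) (X :: real).
        0 < D \<longrightarrow> 0 < \<epsilon> \<longrightarrow> 0 < k \<longrightarrow> 0 < lam \<longrightarrow> 0 \<le> L \<longrightarrow>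
        X = real D + 1 / \<epsilon> + 1 / k + 1 / lam + L \<longrightarrow>
        (\<exists>(T :: nat) (s :: nat) (\<eta> :: real).
          real T \<le> real C * X ^ C \<and>
          0 < \<eta> \<and> 1 / \<eta> \<le> real C * X ^ C \<and>
          1 \<le> s \<and> real s \<le> real C * (1 + ln (real D + 1 / \<epsilon> + L)) ^ C \<and>
          real (s * (T + 1)) \<le> real C * X ^ C \<and>
          (\<forall>(W :: nat) (Astar :: real mat) (\<mu> :: real vec pmf) (r :: real) (m :: real) (A0 :: real mat).
            Astar \<in> carrier_mat W D \<longrightarrow>
            vec_space.rank W Astar = D \<longrightarrow>
            spec_norm Astar \<le> L \<longrightarrow>
            (\<forall>x \<in> set_pmf \<mu>. x \<in> carrier_vec D \<and> (\<forall>i<D. x $ i \<in> {0, 1})) \<longrightarrow>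
            gcc D r k m lam \<mu> \<longrightarrow>
            m \<le> 1 / (2 * 10 ^ 20) * (k * real D * lam ^ 4 / r ^ 5) \<longrightarrow>
            initialization D (1 / 200) Astar A0 \<longrightarrow>
            measure_pmf.prob
              (AND (map_pmf (\<lambda>x. Astar *\<^sub>v x) \<mu>) T \<eta> (replicate s (1 / 4)) A0)
              {A. \<exists>S \<in> carrier_mat D D. diagonal_mat S \<and>
                    loewner_ge S ((1 / 2) \<cdot>\<^sub>m 1\<^sub>m D) \<and>
                    spec_norm (A - Astar * S) \<le> \<epsilon>}
            \<ge> 1 - 1 / X ^ q))"
  proof (rule exI[of _ "2 * q + 20 + 10 ^ 30"], intro allI impI)
    fix D :: nat and \<epsilon> k lam L X :: real
    assume D: "0 < D" and pos: "0 < \<epsilon>" "0 < k" "0 < lam" "0 \<le> L"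
      and X: "X = real D + 1 / \<epsilon> + 1 / k + 1 / lam + L"
    let ?C = "2 * q + 20 + 10 ^ 30 :: nat"
    define \<rho> where "\<rho> = k * lam / (16 * D)"
    obtain T s \<eta> p \<delta> where bounds: "real T \<le> real ?C * X ^ ?C" "0 < \<eta>" "1 / \<eta> \<le> real ?C * X ^ ?C"
        "1 \<le> s" "real s \<le> real ?C * (1 + ln (real D + 1 / \<epsilon> + L)) ^ ?C"
        "real (s * (T + 1)) \<le> real ?C * X ^ ?C"
      and p: "0 < p" "p \<le> 1" "real s * p = 1 / X ^ q" and \<delta>: "0 < \<delta>" "\<delta> = (1 / 200) / (16 * 2 ^ s)"
      and \<eta>: "\<eta> = \<rho> * p * \<delta>\<^sup>2 / (36 * (real D)\<^sup>2)" and n: "2 * D / (\<eta> * \<rho> * p * \<delta>\<^sup>2) \<le> real (Suc T)"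
      and out: "L * ((1 / 200) / 2 ^ s) \<le> \<epsilon>"
      using parameters_exist[OF D pos X \<rho>_def, of q] by blast
    have "1 - 1 / X ^ q \<le> measure_pmf.prob
              (AND (map_pmf (\<lambda>x. Astar *\<^sub>v x) \<mu>) T \<eta> (replicate s (1 / 4)) A0)
              {A. \<exists>S \<in> carrier_mat D D. diagonal_mat S \<and>
                    loewner_ge S ((1 / 2) \<cdot>\<^sub>m 1\<^sub>m D) \<and>
                    spec_norm (A - Astar * S) \<le> \<epsilon>}" (is "_ \<le> measure_pmf.prob ?P ?G")
      if Ast: "Astar \<in> carrier_mat W D" and rk: "vec_space.rank W Astar = D" and nA: "spec_norm Astar \<le> L"
        and bin: "\<forall>x \<in> set_pmf \<mu>. x \<in> carrier_vec D \<and> (\<forall>i<D. x $ i \<in> {0, 1})"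
        and gcc: "gcc D r k m lam \<mu>" and m: "m \<le> 1 / (2 * 10 ^ 20) * (k * real D * lam ^ 4 / r ^ 5)"
        and init: "initialization D (1 / 200) Astar A0"
      for W Astar \<mu> r m A0
    proof -
      interpret binary_gcc D r k "max m 0" lam \<mu>
        by unfold_locales (use D pos bin gcc_max_0[OF gcc] in auto)
      obtain M where M: "M \<in> near_diag D (1 / 4) (1 / 200)" and A0: "A0 = Astar * M"
        by (rule initialization_near_diag[OF init])
      have "0 \<le> 1 / (2 * 10 ^ 20) * (k * real D * lam ^ 4 / r ^ 5)" using pos r_ge_1 by simp
      then have m0: "max m 0 \<le> 1 / (2 * 10 ^ 20) * (k * real D * lam ^ 4 / r ^ 5)" using m by simp
      \<comment> \<open>The initial deviation \<open>0.25\<close> plus the total drift, below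
        \<open>0.19\<close>, keeps every diagonal entry above \<open>1/2\<close>, as the output
        scaling requires.\<close>
      have c: "1 / 4 + 38 * (1 / 200) * (1 - 1 / 2 ^ s) \<le> (1 / 2 :: real)" by (simp add: field_simps)
      have "1 - real s * p \<le> measure_pmf.prob ?P
        ((\<lambda>N. Astar * N) ` near_diag D (1 / 4 + 38 * (1 / 200) * (1 - 1 / 2 ^ s)) (1 / 200 / 2 ^ s))"
        unfolding A0 by (rule AND_prob[OF Ast rank_full_inj[OF Ast rk] m0 \<rho>_def p(1,2) \<delta>(1) \<eta> n M _ c]) (use \<delta> in simp_all)
      also have "\<dots> \<le> measure_pmf.prob ?P ?G"
      proof (rule measure_pmf.finite_measure_mono)
        show "(\<lambda>N. Astar * N) ` near_diag D (1 / 4 + 38 * (1 / 200) * (1 - 1 / 2 ^ s)) (1 / 200 / 2 ^ s) \<subseteq> ?G"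
        proof (rule image_subsetI)
          fix N assume "N \<in> near_diag D (1 / 4 + 38 * (1 / 200) * (1 - 1 / 2 ^ s)) (1 / 200 / 2 ^ s)"
          then have "N \<in> near_diag D (1 / 2) (1 / 200 / 2 ^ s)" by (rule near_diag_mono[OF _ c])
          then show "Astar * N \<in> ?G" using near_diag_output[OF Ast nA pos(4) _ out] by simp
        qed
      qed simp
      finally show ?thesis using p by simp
    qed
    with bounds show "\<exists>(T :: nat) (s :: nat) (\<eta> :: real).
          real T \<le> real ?C * X ^ ?C \<and>
          0 < \<eta> \<and> 1 / \<eta> \<le> real ?C * X ^ ?C \<and>
          1 \<le> s \<and> real s \<le> real ?C * (1 + ln (real D + 1 / \<epsilon> + L)) ^ ?C \<and>
          real (s * (T + 1)) \<le> real ?C * X ^ ?C \<and>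
          (\<forall>(W :: nat) (Astar :: real mat) (\<mu> :: real vec pmf) (r :: real) (m :: real) (A0 :: real mat).
            Astar \<in> carrier_mat W D \<longrightarrow>
            vec_space.rank W Astar = D \<longrightarrow>
            spec_norm Astar \<le> L \<longrightarrow>
            (\<forall>x \<in> set_pmf \<mu>. x \<in> carrier_vec D \<and> (\<forall>i<D. x $ i \<in> {0, 1})) \<longrightarrow>
            gcc D r k m lam \<mu> \<longrightarrow>
            m \<le> 1 / (2 * 10 ^ 20) * (k * real D * lam ^ 4 / r ^ 5) \<longrightarrow>
            initialization D (1 / 200) Astar A0 \<longrightarrow>
            measure_pmf.prob
              (AND (map_pmf (\<lambda>x. Astar *\<^sub>v x) \<mu>) T \<eta> (replicate s (1 / 4)) A0)
              {A. \<exists>S \<in> carrier_mat D D. diagonal_mat S \<and>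
                    loewner_ge S ((1 / 2) \<cdot>\<^sub>m 1\<^sub>m D) \<and>
                    spec_norm (A - Astar * S) \<le> \<epsilon>}
            \<ge> 1 - 1 / X ^ q)"
      by (intro exI[of _ T] exI[of _ s] exI[of _ \<eta>]) simp
  qed
qed simp_all

end
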